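(* Let $n\ge 2$ be a natural number. Then $$\eta(C_n^3)\le 20369(n-1)+1\quad\text{and}\quad s(C_n^3)\le 20370(n-1)+1.$$ Therefore $a_3\le 20369$.
   Context: $C_n$ denotes the cyclic group of order $n$, written additively, and $C_n^3=C_n\oplus C_n\oplus C_n$. For a finite abelian group $G$ with exponent $\exp(G)$, a sequence over $G$ is a finite sequence of elements of $G$ in which repetitions are allowed and order is disregarded (a finite multiset of elements of $G$); its length is the number of its terms counted with multiplicity. A subsequence is a sub-multiset, and it is zero-sum if the sum of its terms (with multiplicity) is $0$. $\eta(G)$ is the smallest natural number $t$ such that every sequence over $G$ of length at least $t$ contains a non-empty zero-sum subsequence of length in $[1,\exp(G)]$. $s(G)$ is the smallest natural number $t$ such that every sequence over $G$ of length at least $t$ contains a zero-sum subsequence of length exactly $\exp(G)$. $a_3$ denotes the smallest positive constant such that $\eta(C_n^3)\le a_3(n-1)+1$ for every natural number $n\geq 1$. *)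

theory Defs
  imports Complex_Main "HOL-Algebra.Elementary_Groups" "HOL-Algebra.FiniteProduct" "HOL-Library.Multiset"
begin

text \<open>
  Groups are HOL-Algebra groups and hence written multiplicatively, although the groups of
  interest are additive: \<open>\<one>\<close> plays the role of \<open>0\<close> and \<open>x [^] k\<close> that of \<open>k x\<close>.
  A sequence over \<open>G\<close> is a finite multiset of elements of \<open>carrier G\<close>, and a subsequence is a
  submultiset.
\<close>

definition group_exponent :: "('a, 'b) monoid_scheme \<Rightarrow> nat" where
  "group_exponent G = (LEAST e. 0 < e \<and> (\<forall>x \<in> carrier G. x [^]\<^bsub>G\<^esub> e = \<one>\<^bsub>G\<^esub>))"

definition seq_sum :: "('a, 'b) monoid_scheme \<Rightarrow> 'a multiset \<Rightarrow> 'a" where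
  "seq_sum G S = finprod G (\<lambda>x. x [^]\<^bsub>G\<^esub> count S x) (set_mset S)"

definition zero_sum :: "('a, 'b) monoid_scheme \<Rightarrow> 'a multiset \<Rightarrow> bool" where
  "zero_sum G S \<longleftrightarrow> seq_sum G S = \<one>\<^bsub>G\<^esub>"

definition eta_const :: "('a, 'b) monoid_scheme \<Rightarrow> nat" where
  "eta_const G = (LEAST t. \<forall>S. set_mset S \<subseteq> carrier G \<and> t \<le> size S \<longrightarrow>
     (\<exists>T. T \<subseteq># S \<and> T \<noteq> {#} \<and> size T \<in> {1..group_exponent G} \<and> zero_sum G T))"

definition s_const :: "('a, 'b) monoid_scheme \<Rightarrow> nat" where
  "s_const G = (LEAST t. \<forall>S. set_mset S \<subseteq> carrier G \<and> t \<le> size S \<longrightarrow>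
     (\<exists>T. T \<subseteq># S \<and> size T = group_exponent G \<and> zero_sum G T))"

definition cyclic_cube :: "nat \<Rightarrow> (int \<times> int \<times> int) monoid" where
  "cyclic_cube n = integer_mod_group n \<times>\<times> integer_mod_group n \<times>\<times> integer_mod_group n"

definition a3 :: real where
  "a3 = (LEAST a. 0 < a \<and> (\<forall>n\<ge>1. real (eta_const (cyclic_cube n)) \<le> a * (real n - 1) + 1))"

end

theory Submission
  imports Defs "HOL-Library.Product_Plus" "HOL-Computational_Algebra.Primes"
begin

text \<open>
Both bounds follow from one statement: among \<open>20370 (n - 1) + 1\<close> vectors of \<open>\<int>\<^sup>3\<close>, repetitions allowed,
there are \<open>n\<close> whose sum is divisible by \<open>n\<close> (\<open>egz_bound_all\<close>). This is the bound for \<open>s\<close>, and the bound for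
\<open>\<eta>\<close> follows by padding a sequence with \<open>n - 1\<close> zeros (\<open>short_zero_sum\<close>). The statement for \<open>m\<close> and
for \<open>n\<close> implies the one for \<open>m n\<close>, with the same constant (\<open>egz_bound_mult\<close>), so it suffices to treat a
prime \<open>p\<close>.

For a prime, the proof follows the method of Alon and Dubiner and distinguishes two cases.

If some affine plane of \<open>C\<^sub>p\<^sup>3\<close> contains \<open>4 p - 2\<close> of the vectors, the problem is two-dimensional and is
solved by Ronyai's form of the polynomial method (\<open>zero_sum_rank_two\<close>): a polynomial of degree below the
number of variables has alternating sum zero over the vertices of the cube, and a suitable such polynomial
would, if there were no zero-sum subset of size \<open>p\<close>, vanish modulo \<open>p\<close> at all vertices but one.

Otherwise no affine plane contains more than \<open>4 p\<close> of the vectors. Comparing with \<open>p\<close> parallel planes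
shows that \<open>p \<ge> 5000\<close>. Disjoint pairs \<open>{a, b}\<close> of vectors are now chosen one after the other, and \<open>Y\<close>
denotes the set of sums with one summand from each pair. A new pair replaces \<open>Y\<close> by a set at least as large
as the union of \<open>Y\<close> and \<open>Y + (b - a)\<close>, so the question is how many new elements the best difference \<open>b - a\<close>
provides. This number, as a function of the shift, is subadditive. A shift by a combination of few
differences that moves \<open>Y\<close> a lot therefore yields a single difference that moves \<open>Y\<close> noticeably. Two
supplies of such combinations are used. Boxes spanned by three independent differences give growth of
order \<open>\<bar>Y\<bar>\<close> to the power \<open>2/3\<close> (\<open>gain_spread\<close>), so that a fixed fraction of \<open>p\<close> steps reaches a fixed
fraction of \<open>p\<^sup>3\<close>. Multiples \<open>j (b - a)\<close> with \<open>j\<close> up to a small fraction of \<open>p\<close> give, by character sums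
and the scarcity of vectors on planes, growth by a factor \<open>1 + c / p\<close> with a large \<open>c\<close> (\<open>gain_fourier\<close>),
which takes \<open>Y\<close> from there to more than half of the group. About \<open>p / 2\<close> pairs suffice for this
(\<open>majority_sums\<close>). Doing it twice with disjoint pairs, \<open>p\<close> in total, gives two sets of sums that each
cover more than half of the group, so that together they represent \<open>0\<close> as a sum of \<open>p\<close> of the vectors
(\<open>zero_sum_of_spread\<close>).
\<close>

section \<open>Zero-sum subsets of length p in rank two\<close>

lemma sum_Pow_insert:
  fixes f :: "'a set \<Rightarrow> int"
  assumes "finite A" "x \<notin> A"
  shows "(\<Sum>I\<in>Pow (insert x A). f I) = (\<Sum>I\<in>Pow A. f I + f (insert x I))"
proof -
  have inj: "inj_on (insert x) (Pow A)"
    using assms(2) by (intro inj_onI) (metis PowD insert_ident subsetD)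
  have "(\<Sum>I\<in>Pow (insert x A). f I) = sum f (Pow A) + sum f (insert x ` Pow A)"
    unfolding Pow_insert using assms by (intro sum.union_disjoint) auto
  also have "sum f (insert x ` Pow A) = (\<Sum>I\<in>Pow A. f (insert x I))"
    using inj by (simp add: sum.reindex)
  finally show ?thesis by (simp add: sum.distrib)
qed

text \<open>
The summand is \<open>(-1) ^ card I\<close> times a polynomial of degree at most \<open>card J + k\<close> in the
indicators of the elements of \<open>A\<close>, and the alternating sum over the cube is the iterated finite
difference in all \<open>card A\<close> directions, which kills every polynomial of smaller degree. In the
induction, taking the difference in the direction \<open>x\<close> either drops a factor of the product or
lowers \<open>k\<close>.
\<close>

lemma alternating_sum_choose_prod:
  fixes c :: "'j \<Rightarrow> int" and a :: "'j \<Rightarrow> 'i \<Rightarrow> int"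
  assumes "finite A" "finite J" "card J + k < card A"
  shows "(\<Sum>I\<in>Pow A. (-1) ^ card I * int (card I choose k) * (\<Prod>j\<in>J. c j + (\<Sum>i\<in>I. a j i))) = 0"
  using assms
proof (induction A arbitrary: J k rule: finite_induct)
  case empty
  then show ?case by simp
next
  case (insert x A)
  define g where "g B I = (\<Prod>j\<in>B. c j + (\<Sum>i\<in>I. a j i))" for B I
  define w where "w B = (\<Prod>j\<in>J - B. a j x)" for B
  have g_insert: "g J (insert x I) = (\<Sum>B\<in>Pow J. w B * g B I)" if "I \<subseteq> A" for I
  proof -
    have "finite I" "x \<notin> I" using that insert by (auto intro: finite_subset)
    then have "g J (insert x I) = (\<Prod>j\<in>J. (c j + (\<Sum>i\<in>I. a j i)) + a j x)"
      unfolding g_def by (intro prod.cong) auto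
    also have "\<dots> = (\<Sum>B\<in>Pow J. w B * g B I)"
      unfolding g_def w_def using insert by (subst prod_add) (auto simp: mult.commute)
    finally show ?thesis .
  qed
  have vanish: "(\<Sum>I\<in>Pow A. (-1) ^ card I * int (card I choose l) * g B I) = 0"
    if "B \<subseteq> J" "card B + l < card A" for B l
    unfolding g_def using that insert by (intro insert.IH) (auto intro: finite_subset)
  have swap: "(\<Sum>I\<in>Pow A. (-1) ^ card I * int (card I choose l) * (\<Sum>B\<in>\<B>. w B * g B I)) = 0"
    if "finite \<B>" "\<And>B. B \<in> \<B> \<Longrightarrow> B \<subseteq> J \<and> card B + l < card A" for \<B> l
  proof -
    have "(\<Sum>I\<in>Pow A. (-1) ^ card I * int (card I choose l) * (\<Sum>B\<in>\<B>. w B * g B I))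
        = (\<Sum>B\<in>\<B>. w B * (\<Sum>I\<in>Pow A. (-1) ^ card I * int (card I choose l) * g B I))"
      unfolding sum_distrib_left by (subst sum.swap) (simp add: mult_ac)
    also have "\<dots> = 0"
      using vanish that by (intro sum.neutral) auto
    finally show ?thesis .
  qed
  have proper: "card B < card J" if "B \<in> Pow J - {J}" for B
    using that insert by (auto intro: psubset_card_mono)
  have wJ: "w J = 1" by (simp add: w_def)
  have split: "(\<Sum>B\<in>Pow J. w B * g B I) = g J I + (\<Sum>B\<in>Pow J - {J}. w B * g B I)" for I
    using insert wJ by (subst sum.remove[of _ J]) auto
  have "(\<Sum>I\<in>Pow (insert x A). (-1) ^ card I * int (card I choose k) * g J I)
      = (\<Sum>I\<in>Pow A. (-1) ^ card I * int (card I choose k) * g J I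
                   + (-1) ^ card (insert x I) * int (card (insert x I) choose k) * g J (insert x I))"
    using insert by (intro sum_Pow_insert) auto
  also have "\<dots> = (\<Sum>I\<in>Pow A. - ((-1) ^ card I * int (card I choose k) * (\<Sum>B\<in>Pow J - {J}. w B * g B I))
      - (if k = 0 then 0 else (-1) ^ card I * int (card I choose (k - 1)) * (\<Sum>B\<in>Pow J. w B * g B I)))"
  proof (intro sum.cong refl)
    fix I assume "I \<in> Pow A"
    then have I: "I \<subseteq> A" by simp
    then have "finite I" "x \<notin> I" using insert by (auto intro: finite_subset)
    then have card: "card (insert x I) = Suc (card I)" by simp
    show "(-1) ^ card I * int (card I choose k) * g J I
          + (-1) ^ card (insert x I) * int (card (insert x I) choose k) * g J (insert x I)
        = - ((-1) ^ card I * int (card I choose k) * (\<Sum>B\<in>Pow J - {J}. w B * g B I))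
          - (if k = 0 then 0 else (-1) ^ card I * int (card I choose (k - 1)) * (\<Sum>B\<in>Pow J. w B * g B I))"
      unfolding card g_insert[OF I] split by (cases k) (auto simp: algebra_simps)
  qed
  also have "\<dots> = 0"
  proof -
    have "(\<Sum>I\<in>Pow A. (-1) ^ card I * int (card I choose k) * (\<Sum>B\<in>Pow J - {J}. w B * g B I)) = 0"
    proof (rule swap)
      fix B assume "B \<in> Pow J - {J}"
      then show "B \<subseteq> J \<and> card B + k < card A" using insert proper[of B] by auto
    qed (use insert in auto)
    moreover have "(\<Sum>I\<in>Pow A. (-1) ^ card I * int (card I choose (k - 1)) * (\<Sum>B\<in>Pow J. w B * g B I)) = 0"
      if "k \<noteq> 0"
    proof (rule swap)
      fix B assume "B \<in> Pow J"
      then have "card B \<le> card J" using insert by (auto intro: card_mono)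
      then show "B \<subseteq> J \<and> card B + (k - 1) < card A" using insert that \<open>B \<in> Pow J\<close> by auto
    qed (use insert in auto)
    ultimately show ?thesis by (cases "k = 0") (simp_all add: sum_subtractf sum_negf)
  qed
  finally show ?case by (simp add: g_def)
qed

text \<open>
A product of \<open>m (p - 1)\<close> affine functions of the indicator of \<open>I\<close>. Modulo a prime \<open>p\<close>, the factors
for one \<open>k\<close> are the sum of \<open>w k\<close> over \<open>I\<close> shifted by all nonzero residues, so the product detects whether all \<open>m\<close> sums are divisible by \<open>p\<close>.
\<close>

definition detect :: "nat \<Rightarrow> nat \<Rightarrow> (nat \<Rightarrow> 'i \<Rightarrow> int) \<Rightarrow> 'i set \<Rightarrow> int" where
  "detect p m w I = (\<Prod>(k, c)\<in>{..<m} \<times> {1..<p}. - int c + (\<Sum>i\<in>I. w k i))"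

lemma detect_dvd_iff:
  assumes "prime p"
  shows "int p dvd detect p m w I \<longleftrightarrow> (\<exists>k<m. \<not> int p dvd (\<Sum>i\<in>I. w k i))"
proof -
  have pos: "p > 0" using assms by (simp add: prime_gt_0_nat)
  have "int p dvd detect p m w I \<longleftrightarrow> (\<exists>k<m. \<exists>c\<in>{1..<p}. int p dvd - int c + (\<Sum>i\<in>I. w k i))"
    unfolding detect_def using assms by (subst prime_dvd_prod_iff) auto
  also have "\<dots> \<longleftrightarrow> (\<exists>k<m. \<not> int p dvd (\<Sum>i\<in>I. w k i))"
  proof -
    have "(\<exists>c\<in>{1..<p}. int p dvd - int c + s) \<longleftrightarrow> \<not> int p dvd s" for s
    proof
      assume "\<exists>c\<in>{1..<p}. int p dvd - int c + s"
      then obtain c where c: "c \<in> {1..<p}" "int p dvd - int c + s" by blast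
      show "\<not> int p dvd s"
      proof
        assume "int p dvd s"
        then have "int p dvd int c" using c(2) by (metis dvd_add_left_iff dvd_minus_iff)
        then show False using c(1) by (auto dest: dvd_imp_le)
      qed
    next
      assume s: "\<not> int p dvd s"
      define c where "c = nat (s mod int p)"
      have "int c = s mod int p" using pos by (simp add: c_def)
      moreover have "s mod int p > 0" using s pos
        by (metis dvd_eq_mod_eq_0 of_nat_0_less_iff order_less_le pos_mod_sign)
      moreover have "s mod int p < int p" using pos by simp
      ultimately have "c \<in> {1..<p}" "int p dvd - int c + s"
        by auto
      then show "\<exists>c\<in>{1..<p}. int p dvd - int c + s" by blast
    qed
    then show ?thesis by simp
  qed
  finally show ?thesis .
qed

lemma alternating_sum_detect:
  assumes "finite A" "m * (p - 1) + k < card A"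
  shows "(\<Sum>I\<in>Pow A. (-1) ^ card I * int (card I choose k) * detect p m w I) = 0"
  using alternating_sum_choose_prod[of A "{..<m} \<times> {1..<p}" k "\<lambda>(_, c). - int c" "\<lambda>(l, _). w l"] assms
  by (simp add: detect_def card_cartesian_product case_prod_unfold)

text \<open>
Of the summands \<open>(p choose k)\<^sup>2\<close> of the central binomial coefficient, only \<open>k = 0\<close> and \<open>k = p\<close>
survive modulo \<open>p\<close>.
\<close>

lemma central_binomial_mod_prime:
  assumes "prime p"
  shows "int p dvd int (2 * p choose p) - 2"
proof -
  have pos: "p > 0" using assms by (simp add: prime_gt_0_nat)
  have "(2 * p choose p) = (\<Sum>k\<le>p. (p choose k)\<^sup>2)" by (simp add: choose_square_sum)
  also have "{..p} = insert 0 (insert p {1..<p})" by auto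
  also have "(\<Sum>k\<in>\<dots>. (p choose k)\<^sup>2) = 2 + (\<Sum>k\<in>{1..<p}. (p choose k)\<^sup>2)"
    using pos by simp
  finally have "int (2 * p choose p) - 2 = int (\<Sum>k\<in>{1..<p}. (p choose k)\<^sup>2)" by simp
  moreover have "p dvd (\<Sum>k\<in>{1..<p}. (p choose k)\<^sup>2)"
  proof (rule dvd_sum)
    fix k assume "k \<in> {1..<p}"
    then have "p dvd p choose k" using assms by (intro dvd_choose_prime) auto
    then show "p dvd (p choose k)\<^sup>2" by (simp add: power2_eq_square)
  qed
  ultimately show ?thesis by (metis int_dvd_int_iff)
qed

text \<open>
Olson's bound for the Davenport constant of \<open>C\<^sub>p\<^sup>m\<close>. If the empty set were the only subset with
all sums divisible by \<open>p\<close>, the alternating sum of \<open>detect\<close> would be \<open>detect p m w {}\<close> modulo \<open>p\<close>,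
which is not divisible by \<open>p\<close>; but the alternating sum is zero.
\<close>

lemma exists_nonempty_zero_sum:
  assumes "prime p" "finite A" "m * (p - 1) < card A"
  shows "\<exists>I\<subseteq>A. I \<noteq> {} \<and> (\<forall>k<m. int p dvd (\<Sum>i\<in>I. w k i))"
proof (rule ccontr)
  assume "\<not> ?thesis"
  then have *: "int p dvd detect p m w I" if "I \<in> Pow A - {{}}" for I
    using that assms(1) by (subst detect_dvd_iff) auto
  have "(\<Sum>I\<in>Pow A. (-1) ^ card I * int (card I choose 0) * detect p m w I)
      = detect p m w {} + (\<Sum>I\<in>Pow A - {{}}. (-1) ^ card I * detect p m w I)"
    using assms by (subst sum.remove[of _ "{}"]) auto
  also have "(\<Sum>I\<in>Pow A. (-1) ^ card I * int (card I choose 0) * detect p m w I) = 0"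
    using assms by (intro alternating_sum_detect) auto
  finally have "detect p m w {} = - (\<Sum>I\<in>Pow A - {{}}. (-1) ^ card I * detect p m w I)" by simp
  moreover have "int p dvd (\<Sum>I\<in>Pow A - {{}}. (-1) ^ card I * detect p m w I)"
    using * by (intro dvd_sum dvd_mult) auto
  ultimately have "int p dvd detect p m w {}" by simp
  then show False using assms(1) by (simp add: detect_dvd_iff)
qed

text \<open>
The third form counts elements. Dropping two elements still leaves enough for a zero-sum subset
\<open>I\<close> whose size is divisible by \<open>p\<close>, that is \<open>p\<close> or \<open>2 p\<close>; in the second case the complement
of \<open>I\<close> has size \<open>p\<close>, and it is zero-sum because the whole set is.
\<close>

lemma zero_sum_3p_contains_p:
  fixes w :: "nat \<Rightarrow> 'i \<Rightarrow> int"
  assumes "prime p" "finite A" "card A = 3 * p" and w2: "\<And>i. w 2 i = 1"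
    and zero: "\<And>k. k < 2 \<Longrightarrow> int p dvd (\<Sum>i\<in>A. w k i)"
  shows "\<exists>T\<subseteq>A. card T = p \<and> (\<forall>k<2. int p dvd (\<Sum>i\<in>T. w k i))"
proof -
  have pos: "p > 0" using assms by (simp add: prime_gt_0_nat)
  obtain B where B: "B \<subseteq> A" "card B = 3 * p - 2"
    using obtain_subset_with_card_n[of "3 * p - 2" A] assms(3) by (metis diff_le_self)
  have fB: "finite B" using B assms by (auto intro: finite_subset)
  have "3 * (p - 1) < card B" using B pos by (simp add: diff_mult_distrib2)
  then obtain I where I: "I \<subseteq> B" "I \<noteq> {}" "\<And>k. k < 3 \<Longrightarrow> int p dvd (\<Sum>i\<in>I. w k i)"
    using exists_nonempty_zero_sum[OF assms(1) fB, of 3 w] by auto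
  have fI: "finite I" using I fB by (auto intro: finite_subset)
  have "p dvd card I" using I(3)[of 2] w2 by simp
  then obtain q where q: "card I = p * q" by (auto elim: dvdE)
  have "card I \<le> 3 * p - 2" using card_mono[OF fB I(1)] B by simp
  then have "p * q < p * 3" using q pos by linarith
  then have "q < 3" by simp
  moreover have "q \<noteq> 0" using q I fI by auto
  ultimately consider "q = 1" | "q = 2" by linarith
  then show ?thesis
  proof cases
    case 1
    then have "card I = p" using q by simp
    moreover have "I \<subseteq> A" using I B by blast
    moreover have "\<forall>k<2. int p dvd (\<Sum>i\<in>I. w k i)" using I(3) by auto
    ultimately show ?thesis by blast
  next
    case 2
    have IA: "I \<subseteq> A" using I B by blast
    have "card (A - I) = p" using q 2 IA fI assms(3) by (simp add: card_Diff_subset)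
    moreover have "int p dvd (\<Sum>i\<in>A - I. w k i)" if "k < 2" for k
      using zero[OF that] I(3)[of k] that IA assms(2) by (subst sum_diff) auto
    ultimately show ?thesis by blast
  qed
qed

text \<open>
Ronyai's bound for the Kemnitz problem, \<open>s(C\<^sub>p\<^sup>2) \<le> 4 p - 2\<close>. Weighting \<open>detect\<close> by
\<open>(card I choose p) - 2\<close> costs \<open>p\<close> in degree and kills the zero-sum sets of size \<open>2 p\<close>; those of
size \<open>3 p\<close> would contain one of size \<open>p\<close>. If there were none of size \<open>p\<close>, only the empty set would
contribute to the alternating sum modulo \<open>p\<close>, and it contributes \<open>-2\<close> times a unit. For \<open>p = 2\<close> this weight degenerates,
but then two elements in the same class are enough.
\<close>

lemma zero_sum_rank_two:
  fixes a b :: "'i \<Rightarrow> int"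
  assumes p: "prime p" and A: "finite A" "4 * p - 2 \<le> card A"
  shows "\<exists>T\<subseteq>A. card T = p \<and> int p dvd (\<Sum>i\<in>T. a i) \<and> int p dvd (\<Sum>i\<in>T. b i)"
proof (cases "p = 2")
  case True
  define f where "f i = (a i mod 2, b i mod 2)" for i
  have "f ` A \<subseteq> {0..1} \<times> {0..1}" unfolding f_def by auto
  then have "card (f ` A) \<le> card ({0..1::int} \<times> {0..1::int})" by (intro card_mono) auto
  then have "\<not> inj_on f A" using A True by (auto dest: card_image)
  then obtain i j where ij: "i \<in> A" "j \<in> A" "i \<noteq> j" "f i = f j" by (auto simp: inj_on_def)
  then have "even (a i) = even (a j)" "even (b i) = even (b j)"
    unfolding f_def by (metis even_iff_mod_2_eq_zero prod.inject)+
  then show ?thesis using ij True by (intro exI[of _ "{i, j}"]) auto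
next
  case False
  then have p3: "p > 2" using p prime_gt_1_nat[of p] by linarith
  obtain B where B: "B \<subseteq> A" "card B = 4 * p - 2"
    using obtain_subset_with_card_n[OF A(2)] by auto
  have fB: "finite B" using B A by (auto intro: finite_subset)
  define w where "w k = (if k = 0 then a else if k = 1 then b else (\<lambda>_. 1))" for k :: nat
  have w2: "w 2 i = 1" for i by (simp add: w_def)
  show ?thesis
  proof (rule ccontr)
    assume contra: "\<not> ?thesis"
    have none: "\<not> (\<forall>k<2. int p dvd (\<Sum>i\<in>T. w k i))" if "T \<subseteq> B" "card T = p" for T
    proof
      assume "\<forall>k<2. int p dvd (\<Sum>i\<in>T. w k i)"
      from spec[OF this, of 0] spec[OF this, of 1] show False
        using contra that B by (auto simp: w_def)
    qed
    define h where "h I = (-1) ^ card I * (int (card I choose p) - 2) * detect p 3 w I" for I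
    have "sum h (Pow B) = (\<Sum>I\<in>Pow B. (-1) ^ card I * int (card I choose p) * detect p 3 w I)
        - 2 * (\<Sum>I\<in>Pow B. (-1) ^ card I * int (card I choose 0) * detect p 3 w I)"
      by (simp add: h_def sum_distrib_left sum_subtractf[symmetric] algebra_simps)
    also have "\<dots> = 0"
    proof -
      have "(\<Sum>I\<in>Pow B. (-1) ^ card I * int (card I choose k) * detect p 3 w I) = 0" if "k \<le> p" for k
        using fB B p3 that by (intro alternating_sum_detect) auto
      from this[of 0] this[of p] show ?thesis by simp
    qed
    finally have "sum h (Pow B) = 0" .
    moreover have "int p dvd sum h (Pow B - {{}})"
    proof (rule dvd_sum)
      fix I assume I: "I \<in> Pow B - {{}}"
      then have fI: "finite I" using fB by (auto intro: finite_subset)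
      show "int p dvd h I"
      proof (cases "int p dvd detect p 3 w I")
        case True
        then show ?thesis by (simp add: h_def)
      next
        case False
        then have z: "\<And>k. k < 3 \<Longrightarrow> int p dvd (\<Sum>i\<in>I. w k i)"
          using p by (auto simp: detect_dvd_iff)
        have "p dvd card I" using z[of 2] w2 by simp
        then obtain q where q: "card I = p * q" by (auto elim: dvdE)
        have "card I \<le> 4 * p - 2" using card_mono[OF fB, of I] I B by auto
        then have "p * q < p * 4" using q p3 by linarith
        then have "q < 4" by simp
        moreover have "q \<noteq> 0" using q I fI by auto
        moreover have "q \<noteq> 1" using none[of I] I q z by auto
        moreover have "q \<noteq> 3"
        proof
          assume "q = 3"
          then obtain T where "T \<subseteq> I" "card T = p" "\<forall>k<2. int p dvd (\<Sum>i\<in>T. w k i)"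
            using zero_sum_3p_contains_p[OF p fI, of w] w2 q z by auto
          then show False using none[of T] I by auto
        qed
        ultimately have "card I = 2 * p" using q by (simp add: less_Suc_eq numeral_eq_Suc)
        then show ?thesis unfolding h_def using central_binomial_mod_prime[OF p] by simp
      qed
    qed
    moreover have "sum h (Pow B) = h {} + sum h (Pow B - {{}})"
      using fB by (subst sum.remove[of _ "{}"]) auto
    ultimately have "int p dvd h {}" by (simp add: add_eq_0_iff2)
    then have "int p dvd 2 * detect p 3 w {}" using p3 by (simp add: h_def binomial_eq_0)
    moreover have "\<not> int p dvd 2" using p3 by (auto dest: zdvd_imp_le)
    ultimately have "int p dvd detect p 3 w {}" using p by (simp add: prime_dvd_mult_iff)
    then show False using p by (simp add: detect_dvd_iff)
  qed
qed

section \<open>Growth of sets under translation\<close>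

text \<open>
Elements of \<open>C\<^sub>n\<^sup>3\<close> are represented by integer vectors, and a subset of \<open>C\<^sub>n\<^sup>3\<close> by its full
preimage in \<open>\<int>\<^sup>3\<close>, which is a periodic set. A translate of such a set is then an honest
translate, without any reduction, and integer vectors that are divisible by \<open>m\<close> can be divided by
\<open>m\<close>, as the passage from \<open>m\<close> and \<open>n\<close> to \<open>m * n\<close> requires.
\<close>

type_synonym vec = "int \<times> int \<times> int"

definition dot :: "vec \<Rightarrow> vec \<Rightarrow> int" where
  "dot x y = fst x * fst y + fst (snd x) * fst (snd y) + snd (snd x) * snd (snd y)"

definition scl :: "int \<Rightarrow> vec \<Rightarrow> vec" where
  "scl j x = (j * fst x, j * fst (snd x), j * snd (snd x))"

definition null_mod :: "nat \<Rightarrow> vec \<Rightarrow> bool" where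
  "null_mod n x \<longleftrightarrow> int n dvd fst x \<and> int n dvd fst (snd x) \<and> int n dvd snd (snd x)"

definition cell :: "nat \<Rightarrow> vec set" where
  "cell n = {0..<int n} \<times> {0..<int n} \<times> {0..<int n}"

definition reduce :: "nat \<Rightarrow> vec \<Rightarrow> vec" where
  "reduce n x = (fst x mod int n, fst (snd x) mod int n, snd (snd x) mod int n)"

definition periodic :: "nat \<Rightarrow> vec set \<Rightarrow> bool" where
  "periodic n Y \<longleftrightarrow> (\<forall>x\<in>Y. \<forall>y. null_mod n (y - x) \<longrightarrow> y \<in> Y)"

text \<open>
For periodic \<open>Y\<close>, the number of residue classes in \<open>Y\<close>.
\<close>

definition msr :: "nat \<Rightarrow> vec set \<Rightarrow> nat" where
  "msr n Y = card (Y \<inter> cell n)"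

text \<open>
The number of residue classes by which \<open>Y\<close> grows when its translate by \<open>d\<close> is added. It is half
the \<open>L\<^sup>1\<close> distance between the indicators of \<open>Y\<close> and of the translate, hence subadditive in \<open>d\<close>.
\<close>

definition gain :: "nat \<Rightarrow> vec set \<Rightarrow> vec \<Rightarrow> nat" where
  "gain n Y d = msr n ((+) d ` Y - Y)"

lemma dot_add_right: "dot x (y + z) = dot x y + dot x z"
  and dot_diff_right: "dot x (y - z) = dot x y - dot x z"
  and dot_scl_right: "dot x (scl j y) = j * dot x y"
  and dot_diff_left: "dot (y - z) x = dot y x - dot z x"
  and dot_zero_right [simp]: "dot x 0 = 0"
  by (simp_all add: dot_def scl_def algebra_simps)

lemma null_mod_0 [simp]: "null_mod n 0"
  by (simp add: null_mod_def)

lemma null_mod_add: "null_mod n x \<Longrightarrow> null_mod n y \<Longrightarrow> null_mod n (x + y)"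
  and null_mod_diff: "null_mod n x \<Longrightarrow> null_mod n y \<Longrightarrow> null_mod n (x - y)"
  and null_mod_uminus: "null_mod n x \<Longrightarrow> null_mod n (- x)"
  by (simp_all add: null_mod_def)

lemma null_mod_dot: "null_mod n x \<Longrightarrow> int n dvd dot u x"
  by (simp add: null_mod_def dot_def)

lemma null_mod_minus_commute: "null_mod n (x - y) \<longleftrightarrow> null_mod n (y - x)"
  using null_mod_uminus[of n "x - y"] null_mod_uminus[of n "y - x"] by auto

lemma scl_Suc: "scl (int (Suc j)) d = d + scl (int j) d"
  and scl_0 [simp]: "scl 0 d = 0"
  by (simp_all add: scl_def prod_eq_iff algebra_simps)

lemma finite_cell [simp]: "finite (cell n)"
  and card_cell: "card (cell n) = n ^ 3"
  by (simp_all add: cell_def card_cartesian_product power3_eq_cube)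

lemma reduce_in_cell: "n > 0 \<Longrightarrow> reduce n x \<in> cell n"
  by (simp add: reduce_def cell_def)

lemma null_mod_reduce: "null_mod n (reduce n x - x)"
  by (simp add: reduce_def null_mod_def mod_eq_dvd_iff[symmetric])

lemma cell_unique:
  assumes "x \<in> cell n" "y \<in> cell n" "null_mod n (x - y)"
  shows "x = y"
proof -
  have *: "a = b" if "0 \<le> a" "a < int n" "0 \<le> b" "b < int n" "int n dvd a - b" for a b
    using that by (metis mod_eq_dvd_iff mod_pos_pos_trivial)
  show ?thesis
    using assms unfolding cell_def null_mod_def by (auto intro: *)
qed

lemma periodicD: "periodic n Y \<Longrightarrow> x \<in> Y \<Longrightarrow> null_mod n (y - x) \<Longrightarrow> y \<in> Y"
  unfolding periodic_def by blast

lemma in_translate_iff: "x \<in> (+) d ` Y \<longleftrightarrow> x - d \<in> Y" for x d :: vec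
proof
  assume "x - d \<in> Y"
  then have "d + (x - d) \<in> (+) d ` Y" by (rule imageI)
  then show "x \<in> (+) d ` Y" by simp
qed auto

lemma periodic_translate: "periodic n Y \<Longrightarrow> periodic n ((+) d ` Y)"
  unfolding periodic_def Ball_def in_translate_iff
proof (intro allI impI)
  fix x y
  assume Y: "\<forall>x. x \<in> Y \<longrightarrow> (\<forall>y. null_mod n (y - x) \<longrightarrow> y \<in> Y)" and "x - d \<in> Y" "null_mod n (y - x)"
  moreover have "(y - d) - (x - d) = y - x" by simp
  ultimately show "y - d \<in> Y" by metis
qed

lemma periodic_Diff: "periodic n Y \<Longrightarrow> periodic n Z \<Longrightarrow> periodic n (Y - Z)"
  unfolding periodic_def using null_mod_minus_commute by blast

lemma periodic_Un: "periodic n Y \<Longrightarrow> periodic n Z \<Longrightarrow> periodic n (Y \<union> Z)"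
  unfolding periodic_def by blast

lemma msr_mono: "Y \<subseteq> Z \<Longrightarrow> msr n Y \<le> msr n Z"
  unfolding msr_def by (intro card_mono) auto

lemma msr_Un_le: "msr n (Y \<union> Z) \<le> msr n Y + msr n Z"
  unfolding msr_def by (simp add: Int_Un_distrib2 card_Un_le)

lemma msr_Int_Diff: "msr n Y = msr n (Y \<inter> Z) + msr n (Y - Z)"
proof -
  have "Y \<inter> cell n = (Y \<inter> Z \<inter> cell n) \<union> ((Y - Z) \<inter> cell n)" by blast
  then show ?thesis
    unfolding msr_def by (simp only:) (rule card_Un_disjoint, auto)
qed

lemma msr_translate:
  assumes n: "n > 0" and Y: "periodic n Y"
  shows "msr n ((+) d ` Y) = msr n Y"
proof -
  have le: "msr n Z \<le> msr n ((+) e ` Z)" if Z: "periodic n Z" for Z e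
    unfolding msr_def
  proof (rule card_inj_on_le[where f = "\<lambda>x. reduce n (e + x)"])
    show "inj_on (\<lambda>x. reduce n (e + x)) (Z \<inter> cell n)"
    proof (rule inj_onI)
      fix x y assume xy: "x \<in> Z \<inter> cell n" "y \<in> Z \<inter> cell n" "reduce n (e + x) = reduce n (e + y)"
      have "null_mod n ((reduce n (e + x) - (e + y)) - (reduce n (e + x) - (e + x)))"
        using null_mod_diff[OF null_mod_reduce[of n "e + y"] null_mod_reduce[of n "e + x"]] xy(3) by simp
      then have "null_mod n (x - y)" by (simp add: algebra_simps)
      then show "x = y" using xy by (intro cell_unique) auto
    qed
    show "(\<lambda>x. reduce n (e + x)) ` (Z \<inter> cell n) \<subseteq> (+) e ` Z \<inter> cell n"
    proof
      fix y assume "y \<in> (\<lambda>x. reduce n (e + x)) ` (Z \<inter> cell n)"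
      then obtain x where x: "x \<in> Z" "y = reduce n (e + x)" by blast
      have "y \<in> (+) e ` Z"
        using periodic_translate[OF Z, of e] x null_mod_reduce by (blast intro: periodicD)
      then show "y \<in> (+) e ` Z \<inter> cell n" using x reduce_in_cell[OF n] by simp
    qed
  qed auto
  have "(+) (- d) ` ((+) d ` Y) = Y" by (simp add: image_image)
  then show ?thesis
    using le[OF Y, of d] le[OF periodic_translate[OF Y, of d], of "- d"] by simp
qed

lemma msr_eq_overlap_plus_gain:
  assumes "n > 0" "periodic n Y"
  shows "msr n Y = msr n ((+) d ` Y \<inter> Y) + gain n Y d"
  using msr_Int_Diff[of n "(+) d ` Y" Y] msr_translate[OF assms, of d] by (simp add: gain_def)

lemma gain_add:
  assumes n: "n > 0" and Y: "periodic n Y"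
  shows "gain n Y (d + e) \<le> gain n Y d + gain n Y e"
proof -
  have "(+) (d + e) ` Y - Y \<subseteq> ((+) d ` Y - Y) \<union> (+) d ` ((+) e ` Y - Y)"
    by (auto simp: in_translate_iff algebra_simps)
  then have "gain n Y (d + e) \<le> msr n (((+) d ` Y - Y) \<union> (+) d ` ((+) e ` Y - Y))"
    unfolding gain_def by (rule msr_mono)
  also have "\<dots> \<le> gain n Y d + msr n ((+) d ` ((+) e ` Y - Y))"
    unfolding gain_def by (rule msr_Un_le)
  also have "msr n ((+) d ` ((+) e ` Y - Y)) = gain n Y e"
    unfolding gain_def using n Y by (intro msr_translate periodic_Diff periodic_translate)
  finally show ?thesis .
qed

lemma gain_0 [simp]: "gain n Y 0 = 0"
  by (simp add: gain_def msr_def)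

text \<open>
This is how a large gain at a long combination of differences is traced back to a single difference.
\<close>

lemma gain_scl:
  assumes "n > 0" "periodic n Y"
  shows "gain n Y (scl (int j) d) \<le> j * gain n Y d"
proof (induction j)
  case 0
  then show ?case by simp
next
  case (Suc j)
  then show ?case
    using gain_add[OF assms, of d "scl (int j) d"] unfolding scl_Suc by simp
qed

text \<open>
There are \<open>n\<^sup>3\<close> linear forms and only \<open>n\<^sup>2\<close> pairs of values at \<open>x\<close> and \<open>y\<close>, so two forms agree there.
\<close>

lemma exists_perp:
  assumes "n > 1"
  shows "\<exists>u. \<not> null_mod n u \<and> int n dvd dot u x \<and> int n dvd dot u y"
proof -
  define f where "f u = (dot u x mod int n, dot u y mod int n)" for u
  have "f ` cell n \<subseteq> {0..<int n} \<times> {0..<int n}" using assms by (auto simp: f_def)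
  then have "card (f ` cell n) \<le> card ({0..<int n} \<times> {0..<int n})" by (intro card_mono) auto
  also have "\<dots> < card (cell n)" using assms by (simp add: card_cartesian_product card_cell power3_eq_cube)
  finally have "\<not> inj_on f (cell n)" by (auto dest: card_image)
  then obtain u w where uw: "u \<in> cell n" "w \<in> cell n" "u \<noteq> w" "f u = f w" unfolding inj_on_def by blast
  have "\<not> null_mod n (u - w)" using cell_unique uw by blast
  moreover have "int n dvd dot (u - w) x" "int n dvd dot (u - w) y"
    using uw(4) by (auto simp: f_def dot_diff_left mod_eq_dvd_iff)
  ultimately show ?thesis by blast
qed

definition independent3 :: "nat \<Rightarrow> vec \<Rightarrow> vec \<Rightarrow> vec \<Rightarrow> bool" where
  "independent3 p d e f \<longleftrightarrow> (\<forall>i j k. null_mod p (scl i d + scl j e + scl k f)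
     \<longrightarrow> int p dvd i \<and> int p dvd j \<and> int p dvd k)"

text \<open>
The differences are chosen together with linear forms \<open>u1\<close>, \<open>u2\<close>, \<open>u3\<close> such that each form is
nonzero at its own difference and vanishes at the earlier ones. By this triangular shape a vanishing
combination has vanishing coefficients.
\<close>

lemma exists_independent_differences:
  fixes v :: "'i \<Rightarrow> vec"
  assumes p: "prime p"
    and spread: "\<And>u t. \<not> null_mod p u \<Longrightarrow> \<exists>i\<in>R. \<not> int p dvd dot u (v i) - t"
  shows "\<exists>a\<in>R. \<exists>b\<in>R. \<exists>c\<in>R. \<exists>r\<in>R. independent3 p (v a - v r) (v b - v r) (v c - v r)"
proof -
  have p1: "p > 1" using p by (rule prime_gt_1_nat)
  obtain u1 where u1: "\<not> null_mod p u1" using exists_perp[OF p1, of 0 0] by blast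
  obtain r where r: "r \<in> R" using spread[OF u1] by blast
  have pick: "\<exists>i\<in>R. \<not> int p dvd dot u (v i - v r)" if "\<not> null_mod p u" for u
    using spread[OF that, of "dot u (v r)"] by (simp add: dot_diff_right)
  obtain a where a: "a \<in> R" "\<not> int p dvd dot u1 (v a - v r)" using pick[OF u1] by blast
  define d where "d = v a - v r"
  obtain u2 where u2: "\<not> null_mod p u2" "int p dvd dot u2 d" using exists_perp[OF p1] by blast
  obtain b where b: "b \<in> R" "\<not> int p dvd dot u2 (v b - v r)" using pick[OF u2(1)] by blast
  define e where "e = v b - v r"
  obtain u3 where u3: "\<not> null_mod p u3" "int p dvd dot u3 d" "int p dvd dot u3 e"
    using exists_perp[OF p1] by blast
  obtain c where c: "c \<in> R" "\<not> int p dvd dot u3 (v c - v r)" using pick[OF u3(1)] by blast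
  define f where "f = v c - v r"
  have "independent3 p d e f"
    unfolding independent3_def
  proof (intro allI impI)
    fix i j k assume null: "null_mod p (scl i d + scl j e + scl k f)"
    have dvd: "int p dvd i * dot u d + j * dot u e + k * dot u f" for u
      using null_mod_dot[OF null, of u] by (simp add: dot_add_right dot_scl_right)
    have drop: "int p dvd z" if "int p dvd y" "int p dvd y + z" for y z
      using that by (simp add: dvd_add_right_iff)
    have ip: "prime (int p)" using p by simp
    have "int p dvd i * dot u3 d + j * dot u3 e" using u3 by (intro dvd_add dvd_mult)
    from drop[OF this dvd[of u3]] have k: "int p dvd k"
      using c(2) prime_dvd_mult_iff[OF ip] by (auto simp: f_def)
    have "int p dvd i * dot u2 d + k * dot u2 f" using u2 k by (intro dvd_add dvd_mult dvd_mult2)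
    moreover have "int p dvd (i * dot u2 d + k * dot u2 f) + j * dot u2 e"
      using dvd[of u2] by (simp only: ac_simps)
    ultimately have "int p dvd j * dot u2 e" by (rule drop)
    then have j: "int p dvd j"
      using b(2) prime_dvd_mult_iff[OF ip] by (auto simp: e_def)
    have "int p dvd j * dot u1 e + k * dot u1 f" using j k by (intro dvd_add dvd_mult2)
    moreover have "int p dvd (j * dot u1 e + k * dot u1 f) + i * dot u1 d"
      using dvd[of u1] by (simp only: ac_simps)
    ultimately have "int p dvd i * dot u1 d" by (rule drop)
    then have "int p dvd i"
      using a(2) prime_dvd_mult_iff[OF ip] by (auto simp: d_def)
    with j k show "int p dvd i \<and> int p dvd j \<and> int p dvd k" by simp
  qed
  then show ?thesis using a b c r unfolding d_def e_def f_def by blast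
qed

text \<open>
The \<open>L ^ 3\<close> combinations with coefficients below \<open>L\<close> are distinct modulo \<open>p\<close>, so the overlaps of
\<open>Y\<close> with its translates by them add up to at most \<open>(msr p Y)\<^sup>2\<close>, the number of pairs in \<open>Y\<close>.
As \<open>L ^ 3\<close> is at least twice \<open>msr p Y\<close>, some overlap is at most half of \<open>Y\<close>, and the corresponding
gain is at least half of \<open>Y\<close>; subadditivity distributes it over the three directions.
\<close>

lemma gain_independent:
  assumes p: "p > 0" and Y: "periodic p Y" and ind: "independent3 p d e f"
    and L: "0 < L" "L \<le> p" "2 * msr p Y \<le> L ^ 3"
  shows "msr p Y \<le> 2 * L * (gain p Y d + gain p Y e + gain p Y f)"
proof -
  define q where "q = (\<lambda>(i, j, k). scl (int i) d + scl (int j) e + scl (int k) f)"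
  define Q where "Q = {..<L} \<times> {..<L} \<times> {..<L}"
  define X where "X j = ((+) (q j) ` Y \<inter> Y) \<inter> cell p" for j
  have fQ: "finite Q" and cQ: "card Q = L ^ 3"
    by (simp_all add: Q_def card_cartesian_product power3_eq_cube)
  have q_inj: "j = j'" if "j \<in> Q" "j' \<in> Q" "null_mod p (q j - q j')" for j j'
  proof -
    obtain a b c a' b' c' where j: "j = (a, b, c)" "j' = (a', b', c')" by (metis prod_cases3)
    have "q j - q j' = scl (int a - int a') d + scl (int b - int b') e + scl (int c - int c') f"
      by (simp add: q_def j scl_def prod_eq_iff algebra_simps)
    then have dvd: "int p dvd int a - int a'" "int p dvd int b - int b'" "int p dvd int c - int c'"
      using ind that(3) unfolding independent3_def by metis+
    have *: "s = t" if "int p dvd int s - int t" "s < L" "t < L" for s t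
      using that L by (metis mod_eq_dvd_iff mod_less of_nat_eq_iff of_nat_mod order_less_le_trans)
    show ?thesis using * dvd that j by (auto simp: Q_def)
  qed
  have "card (Sigma Q X) \<le> card ((Y \<inter> cell p) \<times> (Y \<inter> cell p))"
  proof (rule card_inj_on_le[where f = "\<lambda>(j, z). (z, reduce p (z - q j))"])
    show "inj_on (\<lambda>(j, z). (z, reduce p (z - q j))) (Sigma Q X)"
    proof (rule inj_onI, clarsimp)
      fix a b c a' b' c' x y z
      assume *: "(a, b, c) \<in> Q" "(a', b', c') \<in> Q"
        "reduce p ((x, y, z) - q (a, b, c)) = reduce p ((x, y, z) - q (a', b', c'))"
      have "null_mod p ((reduce p ((x, y, z) - q (a, b, c)) - ((x, y, z) - q (a, b, c)))
         - (reduce p ((x, y, z) - q (a, b, c)) - ((x, y, z) - q (a', b', c'))))"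
        using null_mod_diff[OF null_mod_reduce[of p "(x, y, z) - q (a, b, c)"]
            null_mod_reduce[of p "(x, y, z) - q (a', b', c')"]] *(3) by simp
      then have "null_mod p (q (a, b, c) - q (a', b', c'))" by (simp add: algebra_simps)
      then show "a = a' \<and> b = b' \<and> c = c'" using q_inj[OF *(1,2)] by simp
    qed
    show "(\<lambda>(j, z). (z, reduce p (z - q j))) ` Sigma Q X \<subseteq> (Y \<inter> cell p) \<times> (Y \<inter> cell p)"
    proof
      fix x assume "x \<in> (\<lambda>(j, z). (z, reduce p (z - q j))) ` Sigma Q X"
      then obtain j z where x: "x = (z, reduce p (z - q j))" and "z \<in> X j"
        by (elim imageE SigmaE) force
      then have z: "z - q j \<in> Y" "z \<in> Y" "z \<in> cell p" by (auto simp: X_def in_translate_iff)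
      have "reduce p (z - q j) \<in> Y" using periodicD[OF Y z(1) null_mod_reduce] .
      then show "x \<in> (Y \<inter> cell p) \<times> (Y \<inter> cell p)"
        using x z reduce_in_cell[OF p] by simp
    qed
  qed auto
  moreover have "card (Sigma Q X) = (\<Sum>j\<in>Q. card (X j))"
    using fQ by (intro card_SigmaI) (auto simp: X_def)
  ultimately have sum_le: "(\<Sum>j\<in>Q. card (X j)) \<le> msr p Y * msr p Y"
    by (simp add: card_cartesian_product msr_def)
  have "\<exists>j\<in>Q. msr p Y \<le> 2 * gain p Y (q j)"
  proof (rule ccontr)
    assume "\<not> ?thesis"
    then have less: "2 * gain p Y (q j) < msr p Y" if "j \<in> Q" for j using that by auto
    have big: "msr p Y < 2 * card (X j)" if "j \<in> Q" for j
      using less[OF that] msr_eq_overlap_plus_gain[OF p Y, of "q j"] by (simp add: X_def msr_def)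
    have "Q \<noteq> {}" using L by (auto simp: Q_def)
    then have "(\<Sum>j\<in>Q. msr p Y) < (\<Sum>j\<in>Q. 2 * card (X j))"
      using fQ big by (intro sum_strict_mono) auto
    also have "\<dots> \<le> 2 * (msr p Y * msr p Y)" using sum_le by (simp add: sum_distrib_left[symmetric])
    finally have "L ^ 3 * msr p Y < (2 * msr p Y) * msr p Y" by (simp add: cQ)
    also have "\<dots> \<le> L ^ 3 * msr p Y" using L by (intro mult_right_mono) auto
    finally show False by simp
  qed
  then obtain i j k where ijk: "(i, j, k) \<in> Q" "msr p Y \<le> 2 * gain p Y (q (i, j, k))" by auto
  have step: "gain p Y (scl (int l) x) \<le> L * gain p Y x" if "l < L" for l x
    using gain_scl[OF p Y, of l x] that
    by (meson less_imp_le_nat mult_le_mono1 order_trans)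
  have "gain p Y (q (i, j, k)) \<le> gain p Y (scl (int i) d) + gain p Y (scl (int j) e) + gain p Y (scl (int k) f)"
    using gain_add[OF p Y, of "scl (int i) d + scl (int j) e" "scl (int k) f"]
      gain_add[OF p Y, of "scl (int i) d" "scl (int j) e"] by (simp add: q_def)
  also have "\<dots> \<le> L * gain p Y d + L * gain p Y e + L * gain p Y f"
    using ijk(1) by (intro add_mono step) (auto simp: Q_def)
  finally show ?thesis using ijk(2) by (simp add: algebra_simps)
qed

lemma gain_spread:
  fixes v :: "'i \<Rightarrow> vec"
  assumes p: "prime p" and Y: "periodic p Y"
    and spread: "\<And>u t. \<not> null_mod p u \<Longrightarrow> \<exists>i\<in>R. \<not> int p dvd dot u (v i) - t"
    and L: "0 < L" "L \<le> p" "2 * msr p Y \<le> L ^ 3"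
  shows "\<exists>a\<in>R. \<exists>b\<in>R. msr p Y \<le> 6 * L * gain p Y (v b - v a)"
proof -
  obtain a b c r where R: "a \<in> R" "b \<in> R" "c \<in> R" "r \<in> R"
    and ind: "independent3 p (v a - v r) (v b - v r) (v c - v r)"
    using exists_independent_differences[OF p spread] by blast
  have p0: "p > 0" using p by (simp add: prime_gt_0_nat)
  let ?g = "\<lambda>i. gain p Y (v i - v r)"
  have le: "msr p Y \<le> 2 * L * (?g a + ?g b + ?g c)"
    by (rule gain_independent[OF p0 Y ind L])
  define g where "g = max (?g a) (max (?g b) (?g c))"
  have "2 * L * (?g a + ?g b + ?g c) \<le> 2 * L * (3 * g)"
    by (intro mult_left_mono) (auto simp: g_def)
  with le have "msr p Y \<le> 2 * L * (3 * g)" by (rule order_trans)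
  then have "msr p Y \<le> 6 * L * g" by (simp add: mult_ac)
  moreover have "g = ?g a \<or> g = ?g b \<or> g = ?g c" unfolding g_def by linarith
  ultimately show ?thesis using R by metis
qed

section \<open>Growth by character sums\<close>

text \<open>
The additive character of \<open>C\<^sub>p\<close>.
\<close>

definition ep :: "nat \<Rightarrow> int \<Rightarrow> complex" where
  "ep p k = cis (2 * pi * real_of_int k / real p)"

lemma ep_add: "ep p (k + l) = ep p k * ep p l"
  by (simp add: ep_def cis_mult add_divide_distrib distrib_left)

lemma ep_uminus: "ep p (- k) = cnj (ep p k)"
  by (simp add: ep_def cis_cnj)

lemma ep_0 [simp]: "ep p 0 = 1"
  by (simp add: ep_def)

lemma ep_mult_nat: "ep p (int k * t) = ep p t ^ k"
  by (simp add: ep_def DeMoivre mult_ac)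

lemma ep_eq_1_iff:
  assumes "p > 0"
  shows "ep p k = 1 \<longleftrightarrow> int p dvd k"
proof
  assume "ep p k = 1"
  then have "cos (2 * pi * real_of_int k / real p) = 1"
    by (simp add: ep_def cis.code complex_eq_iff)
  then obtain n :: int where "2 * pi * real_of_int k / real p = real_of_int n * 2 * pi"
    by (auto simp: cos_one_2pi_int)
  then have "real_of_int k = real_of_int (n * int p)"
    using assms by (simp add: field_simps)
  then show "int p dvd k" by (metis dvd_triv_right of_int_eq_iff)
next
  assume "int p dvd k"
  then obtain q where "k = int p * q" by (auto elim: dvdE)
  then have "2 * pi * real_of_int k / real p = 2 * pi * real_of_int q"
    using assms by simp
  then show "ep p k = 1" by (simp add: ep_def)
qed

lemma sum_ep:
  assumes "p > 0"
  shows "(\<Sum>k\<in>{0..<int p}. ep p (k * t)) = (if int p dvd t then of_nat p else 0)"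
proof -
  have "{0..<int p} = int ` {..<p}" by (simp add: lessThan_atLeast0 image_int_atLeastLessThan)
  then have eq: "(\<Sum>k\<in>{0..<int p}. ep p (k * t)) = (\<Sum>k<p. ep p t ^ k)"
    by (simp add: sum.reindex ep_mult_nat)
  show ?thesis
  proof (cases "int p dvd t")
    case True
    then have "ep p t = 1" using assms by (simp add: ep_eq_1_iff)
    then show ?thesis using True eq by simp
  next
    case False
    then have ne: "ep p t \<noteq> 1" using assms by (simp add: ep_eq_1_iff)
    have "ep p t ^ p = ep p (int p * t)" by (simp add: ep_mult_nat)
    also have "\<dots> = 1" using assms by (simp add: ep_eq_1_iff)
    finally show ?thesis using False eq ne by (simp add: geometric_sum)
  qed
qed

lemma sum_cell_ep:
  assumes "p > 0"
  shows "(\<Sum>u\<in>cell p. ep p (dot u x)) = (if null_mod p x then of_nat (p ^ 3) else 0)"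
proof -
  obtain x1 x2 x3 where x: "x = (x1, x2, x3)" by (metis prod_cases3)
  have "(\<Sum>u\<in>cell p. ep p (dot u x))
      = (\<Sum>k\<in>{0..<int p}. ep p (k * x1)) * ((\<Sum>k\<in>{0..<int p}. ep p (k * x2)) * (\<Sum>k\<in>{0..<int p}. ep p (k * x3)))"
    unfolding cell_def dot_def x
    by (simp add: sum_product sum.cartesian_product split_beta ep_add mult.assoc)
  then show ?thesis
    using assms by (auto simp: sum_ep x null_mod_def power3_eq_cube)
qed

definition fourier :: "nat \<Rightarrow> vec set \<Rightarrow> vec \<Rightarrow> complex" where
  "fourier p Y u = (\<Sum>y\<in>Y \<inter> cell p. ep p (dot u y))"

lemma norm_sum_ep_squared:
  "complex_of_real ((cmod (\<Sum>x\<in>A. ep p (f x)))\<^sup>2) = (\<Sum>x\<in>A. \<Sum>y\<in>A. ep p (f x - f y))"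
proof -
  have "complex_of_real ((cmod (\<Sum>x\<in>A. ep p (f x)))\<^sup>2)
      = (\<Sum>x\<in>A. ep p (f x)) * cnj (\<Sum>x\<in>A. ep p (f x))"
    by (simp only: complex_norm_square)
  also have "\<dots> = (\<Sum>x\<in>A. \<Sum>y\<in>A. ep p (f x) * ep p (- f y))"
    by (simp add: sum_product ep_uminus)
  finally show ?thesis by (simp flip: ep_add)
qed

text \<open>
Expanding the squares turns the right-hand side into a sum over pairs \<open>(y, z)\<close> of elements of \<open>Y\<close>;
orthogonality of characters keeps those with \<open>z\<close> congruent to \<open>y + d\<close>.
\<close>

lemma overlap_fourier:
  assumes p: "p > 0" and Y: "periodic p Y"
  shows "complex_of_real (real (p ^ 3) * real (msr p ((+) d ` Y \<inter> Y)))
       = (\<Sum>u\<in>cell p. complex_of_real ((cmod (fourier p Y u))\<^sup>2) * ep p (dot u d))"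
proof -
  define A where "A = Y \<inter> cell p"
  have fA: "finite A" by (simp add: A_def)
  have one: "(\<Sum>y\<in>A. if null_mod p (y + d - z) then 1 else 0 :: complex) = (if z - d \<in> Y then 1 else 0)" for z
  proof (cases "z - d \<in> Y")
    case True
    define r where "r = reduce p (z - d)"
    have "r \<in> A" unfolding A_def r_def
      using periodicD[OF Y True null_mod_reduce] reduce_in_cell[OF p] by simp
    moreover have "null_mod p (y + d - z) \<longleftrightarrow> y = r" if "y \<in> A" for y
    proof
      assume "null_mod p (y + d - z)"
      then have "null_mod p ((y + d - z) - (r - (z - d)))"
        unfolding r_def by (rule null_mod_diff) (rule null_mod_reduce)
      then have "null_mod p (y - r)" by (simp add: algebra_simps)
      then show "y = r" using that \<open>r \<in> A\<close> by (intro cell_unique) (auto simp: A_def)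
    next
      assume "y = r"
      then show "null_mod p (y + d - z)"
        using null_mod_reduce[of p "z - d"] by (simp add: r_def algebra_simps)
    qed
    ultimately have "(\<Sum>y\<in>A. if null_mod p (y + d - z) then 1 else 0 :: complex)
        = (\<Sum>y\<in>A. if y = r then 1 else 0)"
      by (intro sum.cong) auto
    then show ?thesis using True \<open>r \<in> A\<close> fA by simp
  next
    case False
    have "\<not> null_mod p (y + d - z)" if "y \<in> A" for y
    proof
      assume "null_mod p (y + d - z)"
      then have "null_mod p (- (y + d - z))" by (rule null_mod_uminus)
      then have "null_mod p ((z - d) - y)" by (simp add: algebra_simps)
      with that False Y show False by (auto simp: A_def dest: periodicD)
    qed
    then show ?thesis using False by simp
  qed
  have "(\<Sum>u\<in>cell p. complex_of_real ((cmod (fourier p Y u))\<^sup>2) * ep p (dot u d))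
      = (\<Sum>u\<in>cell p. \<Sum>y\<in>A. \<Sum>z\<in>A. ep p (dot u (y + d - z)))"
    unfolding fourier_def norm_sum_ep_squared A_def[symmetric] sum_distrib_right
    by (simp add: dot_add_right dot_diff_right algebra_simps flip: ep_add)
  also have "\<dots> = (\<Sum>z\<in>A. \<Sum>y\<in>A. \<Sum>u\<in>cell p. ep p (dot u (y + d - z)))"
    by (subst sum.swap, subst sum.swap[of _ A "cell p"], subst (2) sum.swap) simp
  also have "\<dots> = (\<Sum>z\<in>A. of_nat (p ^ 3) * (\<Sum>y\<in>A. if null_mod p (y + d - z) then 1 else 0))"
    unfolding sum_cell_ep[OF p] sum_distrib_left by (intro sum.cong) auto
  also have "\<dots> = of_nat (p ^ 3) * of_nat (card {z \<in> A. z - d \<in> Y})"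
    unfolding one using fA by (simp add: sum_distrib_left[symmetric] sum.If_cases Int_def)
  also have "{z \<in> A. z - d \<in> Y} = (+) d ` Y \<inter> Y \<inter> cell p"
    by (auto simp: A_def in_translate_iff)
  finally show ?thesis by (simp add: msr_def)
qed

lemma parseval:
  assumes "p > 0" "periodic p Y"
  shows "(\<Sum>u\<in>cell p. (cmod (fourier p Y u))\<^sup>2) = real (p ^ 3) * real (msr p Y)"
proof -
  have "complex_of_real (\<Sum>u\<in>cell p. (cmod (fourier p Y u))\<^sup>2) = complex_of_real (real (p ^ 3) * real (msr p Y))"
    using overlap_fourier[OF assms, of 0] by simp
  then show ?thesis by (simp only: of_real_eq_iff)
qed

definition character_sum :: "nat \<Rightarrow> ('i \<Rightarrow> vec) \<Rightarrow> 'i set \<Rightarrow> vec \<Rightarrow> int \<Rightarrow> complex" where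
  "character_sum p v R u j = (\<Sum>a\<in>R. ep p (j * dot u (v a)))"

lemma sum_overlap_fourier:
  assumes "p > 0" "periodic p Y"
  shows "real (p ^ 3) * (\<Sum>a\<in>R. \<Sum>b\<in>R. real (msr p ((+) (scl j (v a - v b)) ` Y \<inter> Y)))
       = (\<Sum>u\<in>cell p. (cmod (fourier p Y u))\<^sup>2 * (cmod (character_sum p v R u j))\<^sup>2)"
proof -
  have "complex_of_real (real (p ^ 3) * (\<Sum>a\<in>R. \<Sum>b\<in>R. real (msr p ((+) (scl j (v a - v b)) ` Y \<inter> Y))))
      = (\<Sum>a\<in>R. \<Sum>b\<in>R. \<Sum>u\<in>cell p. complex_of_real ((cmod (fourier p Y u))\<^sup>2) * ep p (dot u (scl j (v a - v b))))"
    unfolding sum_distrib_left of_real_sum overlap_fourier[OF assms] ..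
  also have "\<dots> = (\<Sum>u\<in>cell p. \<Sum>a\<in>R. \<Sum>b\<in>R. complex_of_real ((cmod (fourier p Y u))\<^sup>2) * ep p (dot u (scl j (v a - v b))))"
    by (subst (2) sum.swap, subst sum.swap) simp
  also have "\<dots> = (\<Sum>u\<in>cell p. complex_of_real ((cmod (fourier p Y u))\<^sup>2) * complex_of_real ((cmod (character_sum p v R u j))\<^sup>2))"
    unfolding character_sum_def norm_sum_ep_squared
    by (simp add: sum_distrib_left dot_scl_right dot_diff_right right_diff_distrib)
  also have "\<dots> = complex_of_real (\<Sum>u\<in>cell p. (cmod (fourier p Y u))\<^sup>2 * (cmod (character_sum p v R u j))\<^sup>2)"
    by simp
  finally show ?thesis by (simp only: of_real_eq_iff)
qed

text \<open>
Parseval's identity in the direction of \<open>u\<close>: the sum over \<open>j\<close> counts, with the factor \<open>p\<close>, the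
pairs of elements of \<open>R\<close> on a common plane parallel to the kernel of \<open>u\<close>.
\<close>

lemma sum_character_sum_le:
  assumes p: "p > 0" and R: "finite R"
    and K: "\<And>t. card {i \<in> R. int p dvd dot u (v i) - t} \<le> K"
  shows "(\<Sum>j\<in>{0..<int p}. (cmod (character_sum p v R u j))\<^sup>2) \<le> real (p * K * card R)"
proof -
  have "complex_of_real (\<Sum>j\<in>{0..<int p}. (cmod (character_sum p v R u j))\<^sup>2)
      = (\<Sum>j\<in>{0..<int p}. \<Sum>a\<in>R. \<Sum>b\<in>R. ep p (j * (dot u (v a) - dot u (v b))))"
    unfolding of_real_sum character_sum_def norm_sum_ep_squared by (simp add: right_diff_distrib)
  also have "\<dots> = (\<Sum>a\<in>R. \<Sum>b\<in>R. \<Sum>j\<in>{0..<int p}. ep p (j * (dot u (v a) - dot u (v b))))"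
    by (subst sum.swap, subst (2) sum.swap) simp
  also have "\<dots> = (\<Sum>a\<in>R. of_nat p * of_nat (card {b \<in> R. int p dvd dot u (v a) - dot u (v b)}))"
    unfolding sum_ep[OF p] using R by (simp add: sum.If_cases Int_def mult.commute)
  finally have "complex_of_real (\<Sum>j\<in>{0..<int p}. (cmod (character_sum p v R u j))\<^sup>2)
      = complex_of_real (real (\<Sum>a\<in>R. p * card {b \<in> R. int p dvd dot u (v a) - dot u (v b)}))"
    by simp
  then have "(\<Sum>j\<in>{0..<int p}. (cmod (character_sum p v R u j))\<^sup>2)
      = real (\<Sum>a\<in>R. p * card {b \<in> R. int p dvd dot u (v a) - dot u (v b)})"
    by (simp only: of_real_eq_iff)
  also have "(\<Sum>a\<in>R. p * card {b \<in> R. int p dvd dot u (v a) - dot u (v b)}) \<le> (\<Sum>a\<in>R. p * K)"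
    using K by (intro sum_mono mult_left_mono) (auto simp: dvd_diff_commute)
  finally show ?thesis by (simp add: mult_ac)
qed

text \<open>
The gains at all multiples \<open>j (v b - v a)\<close> with \<open>1 \<le> j \<le> J\<close> are averaged. In terms of characters, the
trivial one contributes at most half of \<open>msr p Y\<close> to the average overlap, because \<open>Y\<close> is at most half
of the group. A nontrivial \<open>u\<close> enters with the sum over \<open>j \<le> J\<close> of the squared character sums at \<open>j u\<close>, which is
at most the sum over all \<open>j < p\<close> and hence at most \<open>p K card R\<close>; this is at most \<open>J (card R)\<^sup>2 / 4\<close>.
So on average a translate gains at least a quarter of \<open>Y\<close>, whereas the gain at the \<open>j\<close>-th multiple
is at most \<open>j\<close> times the gain at the difference itself.
\<close>

lemma gain_fourier:
  fixes v :: "'i \<Rightarrow> vec"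
  assumes p: "p > 0" and Y: "periodic p Y" "2 * msr p Y \<le> p ^ 3"
    and R: "finite R" "R \<noteq> {}"
    and K: "\<And>u t. \<not> null_mod p u \<Longrightarrow> card {i \<in> R. int p dvd dot u (v i) - t} \<le> K"
    and J: "0 < J" "J < p" "4 * p * K \<le> J * card R"
  shows "\<exists>a\<in>R. \<exists>b\<in>R. msr p Y \<le> 2 * (J + 1) * gain p Y (v b - v a)"
proof (rule ccontr)
  assume contra: "\<not> ?thesis"
  define N y P where "N = real (card R)" and "y = real (msr p Y)" and "P = real (p ^ 3)"
  define ov where "ov j a b = real (msr p ((+) (scl (int j) (v b - v a)) ` Y \<inter> Y))" for j a b
  define g where "g j a b = real (gain p Y (scl (int j) (v b - v a)))" for j a b
  have N: "N > 0" using R by (simp add: N_def card_gt_0_iff)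
  have P: "P > 0" using p by (simp add: P_def)
  have y: "y \<ge> 0" "y \<le> P / 2" using Y(2) unfolding y_def P_def by linarith+
  have ov_g: "ov j a b = y - g j a b" for j a b
    using msr_eq_overlap_plus_gain[OF p Y(1), of "scl (int j) (v b - v a)"]
    by (simp add: ov_def g_def y_def)
  define F G where "F u = (cmod (fourier p Y u))\<^sup>2" and "G u j = (cmod (character_sum p v R u (int j)))\<^sup>2" for u j
  have F0: "F 0 = y\<^sup>2" by (simp add: F_def fourier_def y_def msr_def dot_def)
  have G0: "G 0 j = N\<^sup>2" for j by (simp add: G_def character_sum_def N_def dot_def)
  have zero_cell: "0 \<in> cell p" using p by (simp add: cell_def zero_prod_def)
  have G_le: "(\<Sum>j\<in>{1..J}. G u j) \<le> p * K * N" if u: "u \<in> cell p - {0}" for u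
  proof -
    have nu: "\<not> null_mod p u" using cell_unique[of u p 0] u zero_cell by auto
    have "(\<Sum>j\<in>{1..J}. G u j) = (\<Sum>j\<in>int ` {1..J}. (cmod (character_sum p v R u j))\<^sup>2)"
      by (simp add: sum.reindex G_def)
    also have "\<dots> \<le> (\<Sum>j\<in>{0..<int p}. (cmod (character_sum p v R u j))\<^sup>2)"
      using J by (intro sum_mono2) auto
    also have "\<dots> \<le> p * K * N"
      using sum_character_sum_le[OF p R(1) K[OF nu]] by (simp add: N_def)
    finally show ?thesis .
  qed
  have "P * (\<Sum>j\<in>{1..J}. \<Sum>b\<in>R. \<Sum>a\<in>R. ov j a b) = (\<Sum>j\<in>{1..J}. \<Sum>u\<in>cell p. F u * G u j)"
    unfolding ov_def P_def F_def G_def by (subst sum_distrib_left) (simp only: sum_overlap_fourier[OF p Y(1)])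
  also have "\<dots> = (\<Sum>u\<in>cell p. F u * (\<Sum>j\<in>{1..J}. G u j))"
    by (subst sum.swap) (simp add: sum_distrib_left)
  also have "\<dots> = F 0 * (\<Sum>j\<in>{1..J}. G 0 j) + (\<Sum>u\<in>cell p - {0}. F u * (\<Sum>j\<in>{1..J}. G u j))"
    using zero_cell by (subst sum.remove[of _ 0]) auto
  also have "F 0 * (\<Sum>j\<in>{1..J}. G 0 j) = y\<^sup>2 * (J * N\<^sup>2)" by (simp add: F0 G0)
  also have "(\<Sum>u\<in>cell p - {0}. F u * (\<Sum>j\<in>{1..J}. G u j)) \<le> (\<Sum>u\<in>cell p - {0}. F u * (p * K * N))"
    using G_le by (intro sum_mono mult_left_mono) (auto simp: F_def)
  also have "\<dots> \<le> (\<Sum>u\<in>cell p. F u * (p * K * N))"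
    using N by (intro sum_mono2) (auto simp: F_def)
  also have "\<dots> = P * y * (p * K * N)"
    using parseval[OF p Y(1)] by (simp add: sum_distrib_right[symmetric] F_def P_def y_def)
  finally have "P * (\<Sum>j\<in>{1..J}. \<Sum>b\<in>R. \<Sum>a\<in>R. ov j a b) \<le> y\<^sup>2 * (J * N\<^sup>2) + P * y * (p * K * N)"
    by simp
  also have "\<dots> \<le> (P / 2 * y) * (J * N\<^sup>2) + P * y * (J * N / 4 * N)"
  proof (rule add_mono)
    show "y\<^sup>2 * (J * N\<^sup>2) \<le> (P / 2 * y) * (J * N\<^sup>2)"
      using mult_right_mono[OF y(2,1)] by (intro mult_right_mono) (auto simp: power2_eq_square)
    have "real (4 * p * K) \<le> real (J * card R)" using J(3) by (simp only: of_nat_le_iff)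
    then have "p * K \<le> J * N / 4" by (simp add: N_def)
    then show "P * y * (p * K * N) \<le> P * y * (J * N / 4 * N)"
      using P y N by (intro mult_left_mono mult_right_mono) auto
  qed
  also have "\<dots> = P * (3 / 4 * (J * N\<^sup>2 * y))" by (simp add: power2_eq_square field_simps)
  finally have ov_le: "(\<Sum>j\<in>{1..J}. \<Sum>b\<in>R. \<Sum>a\<in>R. ov j a b) \<le> 3 / 4 * (J * N\<^sup>2 * y)"
    using P by simp
  have "(\<Sum>j\<in>{1..J}. \<Sum>b\<in>R. \<Sum>a\<in>R. ov j a b)
      = J * N\<^sup>2 * y - (\<Sum>j\<in>{1..J}. \<Sum>b\<in>R. \<Sum>a\<in>R. g j a b)"
    by (simp add: ov_g sum_subtractf N_def power2_eq_square)
  with ov_le have lower: "J * N\<^sup>2 * y / 4 \<le> (\<Sum>j\<in>{1..J}. \<Sum>b\<in>R. \<Sum>a\<in>R. g j a b)" by linarith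
  have g_less: "g j a b < j * (y / (2 * (J + 1)))" if "a \<in> R" "b \<in> R" "j \<in> {1..J}" for j a b
  proof -
    have "2 * (J + 1) * gain p Y (v b - v a) < msr p Y" using contra that by (meson not_le)
    then have "real (2 * (J + 1) * gain p Y (v b - v a)) < y" unfolding y_def by (simp only: of_nat_less_iff)
    then have "real (gain p Y (v b - v a)) < y / (2 * (J + 1))" by (simp add: field_simps)
    moreover have "g j a b \<le> j * real (gain p Y (v b - v a))"
      using gain_scl[OF p Y(1), of j "v b - v a"] unfolding g_def by (metis of_nat_le_iff of_nat_mult)
    moreover have "real j > 0" using that by simp
    ultimately show ?thesis by (meson mult_less_cancel_left_pos order_le_less_trans)
  qed
  have "(\<Sum>j\<in>{1..J}. \<Sum>b\<in>R. \<Sum>a\<in>R. g j a b) < (\<Sum>j\<in>{1..J}. \<Sum>b\<in>R. \<Sum>a\<in>R. j * (y / (2 * (J + 1))))"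
    using R J g_less by (intro sum_strict_mono) auto
  also have "\<dots> = (\<Sum>j\<in>{1..J}. real j) * (N\<^sup>2 * (y / (2 * (J + 1))))"
    unfolding sum_distrib_right by (intro sum.cong refl) (simp add: N_def power2_eq_square)
  also have "(\<Sum>j\<in>{1..J}. real j) = real J * (real J + 1) / 2"
    using double_gauss_sum_from_Suc_0[of J, where ?'a = real] by simp
  also have "real J * (real J + 1) / 2 * (N\<^sup>2 * (y / (2 * (J + 1)))) = J * N\<^sup>2 * y / 4"
    by (simp add: field_simps)
  finally show False using lower by simp
qed

section \<open>Families modulo a prime\<close>

definition subset_sums :: "nat \<Rightarrow> ('i \<Rightarrow> vec) \<Rightarrow> 'i set \<Rightarrow> nat \<Rightarrow> vec set" where
  "subset_sums p v U h = {x. \<exists>T\<subseteq>U. card T = h \<and> null_mod p (x - sum v T)}"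

lemma periodic_subset_sums: "periodic p (subset_sums p v U h)"
  unfolding periodic_def subset_sums_def
proof (intro ballI allI impI, elim CollectE exE conjE)
  fix x y T assume T: "T \<subseteq> U" "card T = h" "null_mod p (x - sum v T)" and y: "null_mod p (y - x)"
  have "null_mod p ((y - x) + (x - sum v T))" using y T(3) by (rule null_mod_add)
  then show "y \<in> {x. \<exists>T\<subseteq>U. card T = h \<and> null_mod p (x - sum v T)}" using T by auto
qed

lemma translate_subset_sums:
  assumes "finite U" "a \<notin> U"
  shows "(+) (v a) ` subset_sums p v U h \<subseteq> subset_sums p v (insert a U) (Suc h)"
proof
  fix y assume "y \<in> (+) (v a) ` subset_sums p v U h"
  then obtain T where T: "T \<subseteq> U" "card T = h" "null_mod p (y - v a - sum v T)"
    by (auto simp: in_translate_iff subset_sums_def)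
  have "finite T" "a \<notin> T" using T(1) assms by (auto intro: finite_subset)
  then have "card (insert a T) = Suc h" and eq: "y - v a - sum v T = y - sum v (insert a T)"
    using T(2) by (simp_all add: algebra_simps)
  moreover have "insert a T \<subseteq> insert a U" using T(1) by blast
  ultimately show "y \<in> subset_sums p v (insert a U) (Suc h)"
    using T(3) unfolding subset_sums_def eq by blast
qed

lemma msr_subset_sums_insert2:
  fixes v :: "'i \<Rightarrow> vec"
  assumes p: "p > 0" and U: "finite U" "a \<notin> U" "b \<notin> U" "a \<noteq> b"
  shows "msr p (subset_sums p v U h) + gain p (subset_sums p v U h) (v b - v a)
       \<le> msr p (subset_sums p v (insert a (insert b U)) (Suc h))"
proof -
  let ?Y = "subset_sums p v U h"
  let ?Z = "?Y \<union> (+) (v b - v a) ` ?Y"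
  have Y: "periodic p ?Y" by (rule periodic_subset_sums)
  have mono: "subset_sums p v V h' \<subseteq> subset_sums p v W h'" if "V \<subseteq> W" for V W h'
    using that unfolding subset_sums_def by blast
  have "?Z \<inter> ?Y = ?Y" "?Z - ?Y = (+) (v b - v a) ` ?Y - ?Y" by blast+
  then have "msr p ?Y + gain p ?Y (v b - v a) = msr p ?Z"
    using msr_Int_Diff[of p ?Z ?Y] by (simp add: gain_def)
  also have "\<dots> = msr p ((+) (v a) ` ?Z)"
    using Y by (intro msr_translate[symmetric] p periodic_Un periodic_translate)
  also have "\<dots> \<le> msr p (subset_sums p v (insert a (insert b U)) (Suc h))"
  proof (rule msr_mono)
    have "(+) (v a) ` ?Z = (+) (v a) ` ?Y \<union> (+) (v b) ` ?Y"
      by (simp add: image_Un image_image)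
    also have "\<dots> \<subseteq> subset_sums p v (insert a U) (Suc h) \<union> subset_sums p v (insert b U) (Suc h)"
      using U by (intro Un_mono translate_subset_sums)
    also have "\<dots> \<subseteq> subset_sums p v (insert a (insert b U)) (Suc h)"
      by (intro Un_least mono) auto
    finally show "(+) (v a) ` ?Z \<subseteq> subset_sums p v (insert a (insert b U)) (Suc h)" .
  qed
  finally show ?thesis .
qed

text \<open>
A large family with few members on every affine plane. The numbers leave room for using up to
\<open>2 p\<close> members: what is left still has \<open>20000 p\<close> members, so a plane contains at most
one in \<open>5000\<close> of them.
\<close>

locale spread_family =
  fixes p :: nat and v :: "'i \<Rightarrow> vec" and R :: "'i set"
  assumes prime_p: "prime p" and p_large: "5000 \<le> p"
    and finite_R: "finite R" and card_R: "20002 * p \<le> card R"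
    and planes: "\<And>u t. \<not> null_mod p u \<Longrightarrow> card {i \<in> R. int p dvd dot u (v i) - t} \<le> 4 * p"
begin

abbreviation size_sums :: "'i set \<Rightarrow> nat \<Rightarrow> nat" where
  "size_sums U h \<equiv> msr p (subset_sums p v U h)"

lemma p_pos: "p > 0"
  using p_large by simp

lemma card_unused:
  assumes "U \<subseteq> R" "card U = 2 * h" "h \<le> p"
  shows "20000 * p \<le> card (R - U)"
  using assms card_R finite_R by (subst card_Diff_subset) (auto intro: finite_subset)

lemma planes_unused:
  assumes "\<not> null_mod p u"
  shows "card {i \<in> R - U. int p dvd dot u (v i) - t} \<le> 4 * p"
proof -
  have "card {i \<in> R - U. int p dvd dot u (v i) - t} \<le> card {i \<in> R. int p dvd dot u (v i) - t}"
    using finite_R by (intro card_mono) auto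
  then show ?thesis using planes[OF assms, of t] by simp
qed

lemma add_pair:
  assumes U: "U \<subseteq> R" "card U = 2 * h" and ab: "a \<in> R - U" "b \<in> R - U" "a \<noteq> b"
  shows "\<exists>U'\<subseteq>R. card U' = 2 * Suc h \<and>
    size_sums U h + gain p (subset_sums p v U h) (v b - v a) \<le> size_sums U' (Suc h)"
proof -
  have fU: "finite U" using U finite_R by (auto intro: finite_subset)
  have "card (insert a (insert b U)) = 2 * Suc h" "insert a (insert b U) \<subseteq> R"
    using fU U ab by auto
  then show ?thesis
    using msr_subset_sums_insert2[OF p_pos fU, of a b v h] ab by blast
qed

lemma add_any_pair:
  assumes U: "U \<subseteq> R" "card U = 2 * h" "h < p"
  shows "\<exists>U'\<subseteq>R. card U' = 2 * Suc h \<and> size_sums U h \<le> size_sums U' (Suc h)"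
proof -
  have "2 \<le> card (R - U)" using card_unused[of U h] U p_large by simp
  then obtain V where "V \<subseteq> R - U" "card V = 2" by (rule obtain_subset_with_card_n)
  then obtain a b where "a \<in> R - U" "b \<in> R - U" "a \<noteq> b" by (auto simp: card_2_iff)
  from add_pair[OF U(1,2) this] show ?thesis by (meson add_leE)
qed

lemma add_good_pair:
  assumes U: "U \<subseteq> R" "card U = 2 * h" and pos: "size_sums U h > 0"
    and good: "\<exists>a\<in>R - U. \<exists>b\<in>R - U. size_sums U h \<le> D * gain p (subset_sums p v U h) (v b - v a)"
  shows "\<exists>U'\<subseteq>R. card U' = 2 * Suc h \<and> real (size_sums U h) * (1 + 1 / real D) \<le> real (size_sums U' (Suc h))"
proof -
  let ?Y = "subset_sums p v U h"
  obtain a b where ab: "a \<in> R - U" "b \<in> R - U" "msr p ?Y \<le> D * gain p ?Y (v b - v a)"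
    using good by blast
  with pos have "D * gain p ?Y (v b - v a) > 0" by linarith
  then have D: "D > 0" and "a \<noteq> b" by (auto intro!: Nat.gr0I)
  then obtain U' where U': "U' \<subseteq> R" "card U' = 2 * Suc h"
    "msr p ?Y + gain p ?Y (v b - v a) \<le> size_sums U' (Suc h)"
    using add_pair[OF U ab(1,2)] by blast
  have "real (msr p ?Y) \<le> real (D * gain p ?Y (v b - v a))" using ab(3) by (simp only: of_nat_le_iff)
  then have "real (msr p ?Y) * (1 + 1 / real D) \<le> real (msr p ?Y + gain p ?Y (v b - v a))"
    using D by (simp add: field_simps)
  also have "\<dots> \<le> real (size_sums U' (Suc h))" using U'(3) by (simp only: of_nat_le_iff)
  finally show ?thesis using U' by blast
qed

text \<open>
In the first stage the number of sums grows like the cube of the number of pairs. If \<open>y\<close> sums are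
present, an \<open>L\<close> of order \<open>y\<close> to the power \<open>1/3\<close> is admissible in \<open>gain_spread\<close>, so a suitable pair adds
at least \<open>y / (6 L)\<close> sums, which is a constant times the derivative of the cube.
\<close>

lemma cubic_growth:
  assumes "h \<le> p"
  shows "\<exists>U\<subseteq>R. card U = 2 * h \<and> 1 \<le> size_sums U h \<and> (real h / 64) ^ 3 \<le> real (size_sums U h)"
  using assms
proof (induction h)
  case 0
  have "0 \<in> subset_sums p v {} 0 \<inter> cell p"
    using p_pos by (auto simp: subset_sums_def cell_def zero_prod_def null_mod_def)
  then have "card {0::vec} \<le> size_sums {} 0" unfolding msr_def by (intro card_mono) auto
  then show ?case by (intro exI[of _ "{}"]) auto
next
  case (Suc h)
  then obtain U where U: "U \<subseteq> R" "card U = 2 * h"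
    and y: "1 \<le> size_sums U h" "(real h / 64) ^ 3 \<le> real (size_sums U h)" by auto
  define y where "y = real (size_sums U h)"
  show ?case
  proof (cases "(real (Suc h) / 64) ^ 3 \<le> y")
    case True
    then show ?thesis using add_any_pair[OF U] Suc.prems y unfolding y_def
      by (meson Suc_le_lessD of_nat_le_iff order_trans)
  next
    case False
    have h: "64 \<le> h"
    proof (rule ccontr)
      assume "\<not> 64 \<le> h"
      then have "(real (Suc h) / 64) ^ 3 \<le> 1" by (intro power_le_one) auto
      then show False using False y(1) by (simp add: y_def)
    qed
    \<comment> \<open>Since \<open>2 * (50 / 64) ^ 3 < 1\<close>, taking \<open>L\<close> at least \<open>(h + 1) / 50\<close> makes \<open>L ^ 3\<close> exceed twice the number of sums.\<close>
    define L where "L = h div 50 + 1"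
    have L50: "Suc h \<le> 50 * L" "50 * L \<le> h + 50" unfolding L_def by presburger+
    have "real (2 * size_sums U h) \<le> 2 * (real (Suc h) / 64) ^ 3" using False by (simp add: y_def)
    also have "\<dots> \<le> (real (Suc h) / 50) ^ 3"
      by (simp add: power_divide divide_simps mult_right_mono)
    also have "\<dots> \<le> real L ^ 3"
      using L50(1) by (intro power_mono) (simp_all add: divide_simps)
    finally have L3: "2 * size_sums U h \<le> L ^ 3" by (simp only: of_nat_power[symmetric] of_nat_le_iff)
    have LpP: "L \<le> p" using L50 h Suc.prems by linarith
    have spread: "\<exists>i\<in>R - U. \<not> int p dvd dot u (v i) - t" if "\<not> null_mod p u" for u t
    proof (rule ccontr)
      assume "\<not> ?thesis"
      then have "{i \<in> R - U. int p dvd dot u (v i) - t} = R - U" by blast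
      then show False
        using planes_unused[OF that, of U t] card_unused[OF U] Suc.prems p_pos by simp
    qed
    have "\<exists>a\<in>R - U. \<exists>b\<in>R - U. size_sums U h \<le> (6 * L) * gain p (subset_sums p v U h) (v b - v a)"
      using gain_spread[OF prime_p periodic_subset_sums spread _ LpP L3] by (simp add: L_def)
    from add_good_pair[OF U _ this] y(1) obtain U' where U': "U' \<subseteq> R" "card U' = 2 * Suc h"
      and grow: "y * (1 + 1 / real (6 * L)) \<le> real (size_sums U' (Suc h))"
      unfolding y_def by auto
    have "(real (Suc h) / 64) ^ 3 \<le> (real h / 64) ^ 3 * (1 + 1 / real (6 * L))"
    proof -
      define x where "x = real h"
      have x: "x \<ge> 64" using h by (simp add: x_def)
      have x2: "64 * x \<le> x * x" using x by (intro mult_right_mono) auto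
      have L: "real (6 * L) \<le> 22 / 100 * x" "real (6 * L) > 0" using L50 x by (auto simp: x_def L_def)
      have "real (6 * L) * (3 * x ^ 2 + 3 * x + 1) \<le> (22 / 100 * x) * (31 / 10 * x ^ 2)"
      proof (rule mult_mono)
        show "3 * x ^ 2 + 3 * x + 1 \<le> 31 / 10 * x ^ 2"
          using x x2 unfolding power2_eq_square by linarith
      qed (use L x in auto)
      also have "\<dots> \<le> x ^ 3" using x by (simp add: power3_eq_cube power2_eq_square)
      finally have "(3 * x ^ 2 + 3 * x + 1) \<le> x ^ 3 / real (6 * L)" using L by (simp add: pos_le_divide_eq mult.commute)
      then have "(x + 1) ^ 3 \<le> x ^ 3 * (1 + 1 / real (6 * L))"
        by (simp add: power3_eq_cube power2_eq_square algebra_simps)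
      then show ?thesis by (simp add: x_def power_divide add.commute divide_right_mono)
    qed
    also have "\<dots> \<le> y * (1 + 1 / real (6 * L))"
      using y(2) unfolding y_def by (intro mult_right_mono) auto
    finally have "(real (Suc h) / 64) ^ 3 \<le> real (size_sums U' (Suc h))" using grow by linarith
    moreover have "y \<le> y * (1 + 1 / real (6 * L))" by (simp add: y_def algebra_simps)
    then have "1 \<le> size_sums U' (Suc h)" using y(1) grow unfolding y_def by linarith
    ultimately show ?thesis using U' by blast
  qed
qed

text \<open>
In the second stage every pair multiplies the number of sums by at least \<open>1 + 1 / (2 (J + 1))\<close>, where
\<open>J\<close> is about \<open>p / 1250\<close>, as long as at most half of the group is covered. This is much faster than the
first stage once the number of sums is a constant fraction of \<open>p ^ 3\<close>.
\<close>

lemma geometric_growth: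
  fixes U :: "'i set"
  assumes U: "U \<subseteq> R" "card U = 2 * h" "0 < size_sums U h" and n: "h + n \<le> p"
    and J: "J = p div 1250 + 1"
  shows "\<exists>V\<subseteq>R. card V = 2 * (h + n) \<and> 0 < size_sums V (h + n) \<and>
    (p ^ 3 < 2 * size_sums V (h + n) \<or>
     real (size_sums U h) * (1 + 1 / real (2 * (J + 1))) ^ n \<le> real (size_sums V (h + n)))"
  using n
proof (induction n)
  case 0
  then show ?case using U by auto
next
  case (Suc n)
  then obtain V where V: "V \<subseteq> R" "card V = 2 * (h + n)" "0 < size_sums V (h + n)"
    and alt: "p ^ 3 < 2 * size_sums V (h + n) \<or>
     real (size_sums U h) * (1 + 1 / real (2 * (J + 1))) ^ n \<le> real (size_sums V (h + n))"
    by auto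
  have hn: "h + n < p" using Suc.prems by simp
  show ?case
  proof (cases "p ^ 3 < 2 * size_sums V (h + n)")
    case True
    obtain V' where V': "V' \<subseteq> R" "card V' = 2 * Suc (h + n)" "size_sums V (h + n) \<le> size_sums V' (Suc (h + n))"
      using add_any_pair[OF V(1,2) hn] by blast
    then have "p ^ 3 < 2 * size_sums V' (Suc (h + n))" "0 < size_sums V' (Suc (h + n))"
      using True V(3) by linarith+
    then show ?thesis using V' by auto
  next
    case False
    have unused: "20000 * p \<le> card (R - V)" using card_unused[OF V(1,2)] hn by simp
    have "p \<le> 1250 * J"
      using dividend_less_div_times[of 1250 p] unfolding J by simp
    \<comment> \<open>With at most \<open>K = 4 * p\<close> members per plane, \<open>J\<close> has to satisfy \<open>4 * p * K \<le> J * card (R - V)\<close>.\<close>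
    then have "16 * p * p \<le> 16 * (1250 * J) * p" by (intro mult_right_mono) auto
    also have "\<dots> = J * (20000 * p)" by simp
    also have "\<dots> \<le> J * card (R - V)" using unused by (intro mult_left_mono) auto
    finally have Jcard: "4 * p * (4 * p) \<le> J * card (R - V)" by simp
    have "card (R - V) \<noteq> 0" using unused p_pos by simp
    then have "R - V \<noteq> {}" by (metis card.empty)
    moreover have "0 < J" "J < p" using p_large unfolding J by linarith+
    ultimately have "\<exists>a\<in>R - V. \<exists>b\<in>R - V. size_sums V (h + n)
        \<le> 2 * (J + 1) * gain p (subset_sums p v V (h + n)) (v b - v a)"
      using gain_fourier[OF p_pos periodic_subset_sums _ _ _ planes_unused _ _ Jcard, of v V "h + n"]
        False finite_R by auto
    from add_good_pair[OF V this] obtain V' where V': "V' \<subseteq> R" "card V' = 2 * Suc (h + n)"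
      and grow: "real (size_sums V (h + n)) * (1 + 1 / real (2 * (J + 1))) \<le> real (size_sums V' (Suc (h + n)))"
      by blast
    have "real (size_sums U h) * (1 + 1 / real (2 * (J + 1))) ^ Suc n
        \<le> real (size_sums V (h + n)) * (1 + 1 / real (2 * (J + 1)))"
      using alt False mult_right_mono[of "real (size_sums U h) * (1 + 1 / real (2 * (J + 1))) ^ n"
          "real (size_sums V (h + n))" "1 + 1 / real (2 * (J + 1))"]
      by (simp add: mult_ac)
    then have "real (size_sums U h) * (1 + 1 / real (2 * (J + 1))) ^ Suc n \<le> real (size_sums V' (Suc (h + n)))"
      using grow by linarith
    moreover have "0 < real (size_sums V (h + n)) * (1 + 1 / real (2 * (J + 1)))"
      using V(3) by (intro mult_pos_pos) (auto simp: add_pos_nonneg)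
    then have "0 < size_sums V' (Suc (h + n))" using grow by (simp only: of_nat_0_less_iff[symmetric, where ?'a = real])
    ultimately show ?thesis using V' by auto
  qed
qed

text \<open>
A quarter of \<open>p\<close> pairs is spent on the first stage, after which there are at least \<open>(p / 320) ^ 3\<close>
sums; since \<open>2 ^ 25 > 320 ^ 3\<close>, doubling this \<open>25\<close> times is enough. A doubling takes about \<open>p / 625\<close> pairs.
\<close>

lemma majority_sums:
  assumes h: "p \<le> 2 * h + 2" "h \<le> p"
  shows "\<exists>U\<subseteq>R. card U = 2 * h \<and> p ^ 3 < 2 * size_sums U h"
proof -
  define h0 where "h0 = p div 4"
  define n where "n = h - h0"
  define J where "J = p div 1250 + 1"
  define D where "D = 2 * (J + 1)"
  have D: "D = 2 * J + 2" by (simp add: D_def)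
  have hn: "h = h0 + n" using h p_large by (simp add: n_def h0_def)
  have "p \<le> 5 * h0" using p_large unfolding h0_def by linarith
  have "1250 * J \<le> p + 1250" unfolding J_def by simp
  moreover have "4 * h0 \<le> p" unfolding h0_def by simp
  ultimately have nD: "D * 25 \<le> n" using h p_large hn D by linarith
  obtain U where U: "U \<subseteq> R" "card U = 2 * h0" "0 < size_sums U h0"
    and U_size: "(real h0 / 64) ^ 3 \<le> real (size_sums U h0)"
    using cubic_growth[of h0] by (auto simp: h0_def)
  obtain V where V: "V \<subseteq> R" "card V = 2 * h"
    and alt: "p ^ 3 < 2 * size_sums V h \<or> real (size_sums U h0) * (1 + 1 / real D) ^ n \<le> real (size_sums V h)"
    using geometric_growth[OF U, of n J] h hn by (auto simp: J_def D_def)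
  have "p ^ 3 < 2 * size_sums V h"
  proof (cases "p ^ 3 < 2 * size_sums V h")
    case False
    have "D > 0" by (simp add: D_def)
    have "(2::real) = 1 + real D * (1 / real D)" using \<open>D > 0\<close> by simp
    also have "\<dots> \<le> (1 + 1 / real D) ^ D" by (rule Bernoulli_inequality) (simp add: order_trans[of _ 0])
    finally have "(2::real) ^ 25 \<le> ((1 + 1 / real D) ^ D) ^ 25" by (intro power_mono) auto
    also have "\<dots> = (1 + 1 / real D) ^ (D * 25)" by (simp add: power_mult)
    also have "\<dots> \<le> (1 + 1 / real D) ^ n" using nD by (intro power_increasing) auto
    finally have pow: "(2::real) ^ 25 \<le> (1 + 1 / real D) ^ n" .
    have "real p / 320 \<le> real h0 / 64" using \<open>p \<le> 5 * h0\<close> by simp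
    then have "(real p / 320) ^ 3 \<le> (real h0 / 64) ^ 3" by (intro power_mono) auto
    then have "(real p / 320) ^ 3 \<le> real (size_sums U h0)" using U_size by (rule order_trans)
    then have "(real p / 320) ^ 3 * 2 ^ 25 \<le> real (size_sums U h0) * (1 + 1 / real D) ^ n"
      using pow by (rule mult_mono) simp_all
    also have "\<dots> \<le> real (size_sums V h)" using alt False by simp
    finally have "real p ^ 3 * (128 / 125) \<le> real (size_sums V h)" by (simp add: power_divide)
    moreover have "real p ^ 3 > 0" using p_pos by simp
    ultimately have "real p ^ 3 < 2 * real (size_sums V h)" by linarith
    then have "real (p ^ 3) < real (2 * size_sums V h)" by simp
    then show ?thesis by (simp only: of_nat_less_iff)
  qed
  then show ?thesis using V by blast
qed

end

text \<open>
Two disjoint sets of pairs are spent, and the sums of each cover more than half of the group. Hence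
some sum \<open>z\<close> of the second kind has a negative among the sums of the first kind. The numbers of
summands add up to \<open>p\<close>.
\<close>

lemma zero_sum_of_spread:
  fixes v :: "'i \<Rightarrow> vec"
  assumes p: "prime p" "5000 \<le> p" and R: "finite R" "20004 * p \<le> card R"
    and planes: "\<And>u t. \<not> null_mod p u \<Longrightarrow> card {i \<in> R. int p dvd dot u (v i) - t} \<le> 4 * p"
  shows "\<exists>T\<subseteq>R. card T = p \<and> null_mod p (sum v T)"
proof -
  define h1 h2 where "h1 = p div 2" and "h2 = p - p div 2"
  have h: "p \<le> 2 * h1 + 2" "h1 \<le> p" "p \<le> 2 * h2 + 2" "h2 \<le> p"
    unfolding h1_def h2_def by linarith+
  interpret A: spread_family p v R
    using assms by unfold_locales auto
  obtain U1 where U1: "U1 \<subseteq> R" "card U1 = 2 * h1" "p ^ 3 < 2 * msr p (subset_sums p v U1 h1)"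
    using A.majority_sums[OF h(1,2)] by blast
  interpret B: spread_family p v "R - U1"
  proof
    show "20002 * p \<le> card (R - U1)"
      using R U1 by (subst card_Diff_subset) (auto intro: finite_subset simp: h1_def)
  qed (use p R A.planes_unused in auto)
  obtain U2 where U2: "U2 \<subseteq> R - U1" "p ^ 3 < 2 * msr p (subset_sums p v U2 h2)"
    using B.majority_sums[OF h(3,4)] by blast
  let ?Y1 = "subset_sums p v U1 h1 \<inter> cell p" and ?Y2 = "subset_sums p v U2 h2 \<inter> cell p"
  let ?f = "\<lambda>z. reduce p (- z)"
  have inj: "inj_on ?f ?Y2"
  proof (rule inj_onI)
    fix x y assume xy: "x \<in> ?Y2" "y \<in> ?Y2" "?f x = ?f y"
    have "null_mod p ((?f x - - x) - (?f y - - y))" by (rule null_mod_diff) (rule null_mod_reduce)+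
    then have "null_mod p (x - y)" using xy(3) by simp
    then show "x = y" using xy by (intro cell_unique) auto
  qed
  have "?Y1 \<inter> ?f ` ?Y2 \<noteq> {}"
  proof
    assume "?Y1 \<inter> ?f ` ?Y2 = {}"
    then have "card ?Y1 + card (?f ` ?Y2) = card (?Y1 \<union> ?f ` ?Y2)" by (subst card_Un_disjoint) auto
    also have "\<dots> \<le> card (cell p)" using reduce_in_cell[OF A.p_pos] by (intro card_mono) auto
    finally have "msr p (subset_sums p v U1 h1) + msr p (subset_sums p v U2 h2) \<le> p ^ 3"
      using inj by (simp add: msr_def card_cell card_image)
    then show False using U1 U2 by simp
  qed
  then obtain z where z: "z \<in> ?Y2" "?f z \<in> ?Y1" by blast
  obtain T1 where T1: "T1 \<subseteq> U1" "card T1 = h1" "null_mod p (?f z - sum v T1)"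
    using z by (auto simp: subset_sums_def)
  obtain T2 where T2: "T2 \<subseteq> U2" "card T2 = h2" "null_mod p (z - sum v T2)"
    using z by (auto simp: subset_sums_def)
  have fin: "finite T1" "finite T2"
    using T1 T2 U1 U2 R by (meson Diff_subset finite_subset subset_trans)+
  have disj: "T1 \<inter> T2 = {}" using T1 T2 U1 U2 by blast
  have "null_mod p (((?f z - - z) - (?f z - sum v T1)) - (z - sum v T2))"
    using T1 T2 by (intro null_mod_diff[OF null_mod_diff] null_mod_reduce)
  then have "null_mod p (sum v T1 + sum v T2)" by (simp add: algebra_simps)
  then have "null_mod p (sum v (T1 \<union> T2))" using fin disj by (simp add: sum.union_disjoint)
  moreover have "card (T1 \<union> T2) = p"
    using fin disj T1 T2 by (simp add: card_Un_disjoint h1_def h2_def)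
  moreover have "T1 \<union> T2 \<subseteq> R" using T1 T2 U1 U2 by blast
  ultimately show ?thesis by blast
qed

lemma dot_sum_right: "dot u (sum v T) = (\<Sum>i\<in>T. dot u (v i))"
  by (induction T rule: infinite_finite_induct) (simp_all add: dot_add_right)

text \<open>
Two of the coordinates are handled by \<open>zero_sum_rank_two\<close>. The third one, at a nonzero coefficient
of \<open>u\<close>, follows from the equation of the plane: over \<open>p\<close> members the constant \<open>t\<close> contributes \<open>p * t\<close>.
\<close>

lemma zero_sum_affine_plane:
  fixes v :: "'i \<Rightarrow> vec"
  assumes p: "prime p" and A: "finite A" "4 * p - 2 \<le> card A"
    and u: "\<not> null_mod p u" and plane: "\<And>i. i \<in> A \<Longrightarrow> int p dvd dot u (v i) - t"
  shows "\<exists>T\<subseteq>A. card T = p \<and> null_mod p (sum v T)"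
proof -
  obtain u1 u2 u3 where u_eq: "u = (u1, u2, u3)" by (metis prod_cases3)
  define x y z where "x = (\<lambda>i. fst (v i))" and "y = (\<lambda>i. fst (snd (v i)))" and "z = (\<lambda>i. snd (snd (v i)))"
  have coords: "fst (sum v T) = sum x T" "fst (snd (sum v T)) = sum y T" "snd (snd (sum v T)) = sum z T" for T
    by (simp_all add: x_def y_def z_def fst_sum snd_sum)
  have relation: "int p dvd u1 * sum x T + u2 * sum y T + u3 * sum z T" if T: "T \<subseteq> A" "card T = p" for T
  proof -
    have "int p dvd (\<Sum>i\<in>T. dot u (v i) - t) + int (card T) * t"
      using plane T by (intro dvd_add dvd_sum) auto
    also have "(\<Sum>i\<in>T. dot u (v i) - t) + int (card T) * t = dot u (sum v T)"
      by (simp add: sum_subtractf dot_sum_right)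
    also have "dot u (sum v T) = u1 * sum x T + u2 * sum y T + u3 * sum z T"
      by (simp add: dot_def u_eq coords)
    finally show ?thesis .
  qed
  have cancel: "int p dvd s" if "int p dvd w + c * s" "int p dvd w" "\<not> int p dvd c" for w c s
    using that p by (simp add: dvd_add_right_iff prime_dvd_mult_iff)
  have null: "null_mod p (sum v T) \<longleftrightarrow> int p dvd sum x T \<and> int p dvd sum y T \<and> int p dvd sum z T" for T
    by (simp add: null_mod_def coords)
  consider "\<not> int p dvd u1" | "\<not> int p dvd u2" | "\<not> int p dvd u3"
    using u by (auto simp: null_mod_def u_eq)
  then show ?thesis
  proof cases
    case 1
    obtain T where T: "T \<subseteq> A" "card T = p" "int p dvd sum y T" "int p dvd sum z T"
      using zero_sum_rank_two[OF p A, of y z] by auto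
    have "int p dvd (u2 * sum y T + u3 * sum z T) + u1 * sum x T"
      using relation[OF T(1,2)] by (simp only: ac_simps)
    moreover have "int p dvd u2 * sum y T + u3 * sum z T" using T(3,4) by (intro dvd_add dvd_mult)
    ultimately have "int p dvd sum x T" using 1 by (rule cancel)
    then show ?thesis using T null by blast
  next
    case 2
    obtain T where T: "T \<subseteq> A" "card T = p" "int p dvd sum x T" "int p dvd sum z T"
      using zero_sum_rank_two[OF p A, of x z] by auto
    have "int p dvd (u1 * sum x T + u3 * sum z T) + u2 * sum y T"
      using relation[OF T(1,2)] by (simp only: ac_simps)
    moreover have "int p dvd u1 * sum x T + u3 * sum z T" using T(3,4) by (intro dvd_add dvd_mult)
    ultimately have "int p dvd sum y T" using 2 by (rule cancel)
    then show ?thesis using T null by blast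
  next
    case 3
    obtain T where T: "T \<subseteq> A" "card T = p" "int p dvd sum x T" "int p dvd sum y T"
      using zero_sum_rank_two[OF p A, of x y] by auto
    have "int p dvd (u1 * sum x T + u2 * sum y T) + u3 * sum z T"
      using relation[OF T(1,2)] .
    moreover have "int p dvd u1 * sum x T + u2 * sum y T" using T(3,4) by (intro dvd_add dvd_mult)
    ultimately have "int p dvd sum z T" using 3 by (rule cancel)
    then show ?thesis using T null by blast
  qed
qed

text \<open>
Either some affine plane contains at least \<open>4 p - 2\<close> members, or the family is spread. In the second case
\<open>p\<close> is at least \<open>5000\<close>, because \<open>p\<close> parallel planes with at most \<open>4 p\<close> members each cover the family.
\<close>

lemma zero_sum_prime:
  fixes v :: "'i \<Rightarrow> vec"
  assumes p: "prime p" and I: "finite I" "20370 * (p - 1) + 1 \<le> card I"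
  shows "\<exists>T\<subseteq>I. card T = p \<and> null_mod p (sum v T)"
proof (cases "\<exists>u t. \<not> null_mod p u \<and> 4 * p - 2 \<le> card {i \<in> I. int p dvd dot u (v i) - t}")
  case True
  then obtain u t where ut: "\<not> null_mod p u" "4 * p - 2 \<le> card {i \<in> I. int p dvd dot u (v i) - t}"
    by blast
  have "\<exists>T\<subseteq>{i \<in> I. int p dvd dot u (v i) - t}. card T = p \<and> null_mod p (sum v T)"
    using I(1) ut by (intro zero_sum_affine_plane[OF p _ ut(2) ut(1), where t = t]) auto
  then show ?thesis by blast
next
  case False
  have p2: "p \<ge> 2" using p by (simp add: prime_ge_2_nat)
  have planes: "card {i \<in> I. int p dvd dot u (v i) - t} \<le> 4 * p" if "\<not> null_mod p u" for u t
    using False that by (meson diff_le_self le_cases le_trans)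
  define e :: vec where "e = (1, 0, 0)"
  have e: "\<not> null_mod p e" using p2 by (auto simp: e_def null_mod_def dest: zdvd_imp_le)
  have cover: "I = (\<Union>t\<in>{0..<int p}. {i \<in> I. int p dvd dot e (v i) - t})"
  proof (intro subset_antisym subsetI)
    fix i assume "i \<in> I"
    moreover have "int p dvd dot e (v i) - dot e (v i) mod int p" by simp
    moreover have "dot e (v i) mod int p \<in> {0..<int p}" using p2 by simp
    ultimately show "i \<in> (\<Union>t\<in>{0..<int p}. {i \<in> I. int p dvd dot e (v i) - t})" by blast
  qed auto
  have "card (\<Union>t\<in>{0..<int p}. {i \<in> I. int p dvd dot e (v i) - t})
      \<le> (\<Sum>t\<in>{0..<int p}. card {i \<in> I. int p dvd dot e (v i) - t})"
    by (intro card_UN_le) simp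
  with arg_cong[OF cover, of card]
  have "card I \<le> (\<Sum>t\<in>{0..<int p}. card {i \<in> I. int p dvd dot e (v i) - t})"
    by (rule ord_eq_le_trans)
  also have "\<dots> \<le> (\<Sum>t\<in>{0..<int p}. 4 * p)" using planes[OF e] by (intro sum_mono) auto
  finally have card_le: "card I \<le> p * (4 * p)" by simp
  have "5000 \<le> p"
  proof (rule ccontr)
    assume "\<not> 5000 \<le> p"
    then have small: "p \<le> 5000" by simp
    \<comment> \<open>A linear bound for \<open>4 * p\<^sup>2\<close> from \<open>p \<le> 5000\<close> alone is too weak for small \<open>p\<close>, where \<open>p - 1\<close> is far from \<open>p\<close>.\<close>
    show False
    proof (cases "p \<le> 100")
      case True
      then have "p * (4 * p) \<le> 100 * (4 * p)" by (intro mult_right_mono) auto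
      also have "\<dots> = 400 * p" by simp
      finally show False using card_le I(2) p2 by linarith
    next
      case False
      have "p * (4 * p) \<le> 5000 * (4 * p)" using small by (intro mult_right_mono) auto
      also have "\<dots> = 20000 * p" by simp
      finally show False using card_le I(2) False by linarith
    qed
  qed
  moreover from this have "20004 * p \<le> card I" using I(2) by simp
  ultimately show ?thesis using zero_sum_of_spread[OF p _ I(1) _ planes] by blast
qed

section \<open>From primes to all moduli\<close>

text \<open>
The bound \<open>s(C\<^sub>n\<^sup>3) \<le> C (n - 1) + 1\<close> for families of integer vectors. With this shape,
the bounds for \<open>m\<close> and \<open>n\<close> imply the one for \<open>m n\<close> without loss in \<open>C\<close>.
\<close>

definition egz_bound :: "nat \<Rightarrow> nat \<Rightarrow> bool" where
  "egz_bound C n \<longleftrightarrow> (\<forall>(I::nat set) v. finite I \<longrightarrow> C * (n - 1) + 1 \<le> card I \<longrightarrow>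
     (\<exists>T\<subseteq>I. card T = n \<and> null_mod n (sum v T)))"

lemma egz_boundD:
  assumes "egz_bound C n" "finite (I::nat set)" "C * (n - 1) + 1 \<le> card I"
  obtains T where "T \<subseteq> I" "card T = n" "null_mod n (sum v T)"
  using assms unfolding egz_bound_def by blast

lemma egz_bound_1: "egz_bound C 1"
  unfolding egz_bound_def
proof (intro allI impI)
  fix I :: "nat set" and v :: "nat \<Rightarrow> vec"
  assume "C * (1 - 1) + 1 \<le> card I"
  then obtain T where "T \<subseteq> I" "card T = 1" using obtain_subset_with_card_n[of 1 I] by auto
  then show "\<exists>T\<subseteq>I. card T = 1 \<and> null_mod 1 (sum v T)" by (auto simp: null_mod_def)
qed

lemma disjoint_zero_sum_blocks:
  assumes m: "egz_bound C m" and I: "finite (I::nat set)" "C * (m - 1) + 1 + k * m \<le> card I"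
  shows "\<exists>B :: nat \<Rightarrow> nat set. (\<forall>i\<le>k. B i \<subseteq> I \<and> card (B i) = m \<and> null_mod m (sum v (B i))) \<and>
    (\<forall>i\<le>k. \<forall>j\<le>k. i \<noteq> j \<longrightarrow> B i \<inter> B j = {})"
  using I
proof (induction k arbitrary: I)
  case 0
  then obtain T where "T \<subseteq> I" "card T = m" "null_mod m (sum v T)"
    using egz_boundD[OF m, of I v] by auto
  then show ?case by (intro exI[of _ "\<lambda>_. T"]) simp
next
  case (Suc k)
  have "C * (m - 1) + 1 \<le> card I" using Suc.prems(2) by linarith
  then obtain T where T: "T \<subseteq> I" "card T = m" "null_mod m (sum v T)"
    using egz_boundD[OF m Suc.prems(1), of v] by blast
  have "card (I - T) = card I - m"
    using T Suc.prems(1) by (subst card_Diff_subset) (auto intro: finite_subset)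
  then have "C * (m - 1) + 1 + k * m \<le> card (I - T)" using Suc.prems(2) by simp
  moreover have "finite (I - T)" using Suc.prems(1) by simp
  ultimately obtain B where B:
    "\<forall>i\<le>k. B i \<subseteq> I - T \<and> card (B i) = m \<and> null_mod m (sum v (B i))"
    "\<forall>i\<le>k. \<forall>j\<le>k. i \<noteq> j \<longrightarrow> B i \<inter> B j = {}"
    using Suc.IH[of "I - T"] by blast
  define B' where "B' i = (if i \<le> k then B i else T)" for i
  have "B' i \<subseteq> I \<and> card (B' i) = m \<and> null_mod m (sum v (B' i))" if "i \<le> Suc k" for i
    using B(1) T unfolding B'_def by auto
  moreover have "B' i \<inter> B' j = {}" if ij: "i \<le> Suc k" "j \<le> Suc k" "i \<noteq> j" for i j
  proof -
    consider "i \<le> k" "j \<le> k" | "i \<le> k" "\<not> j \<le> k" | "\<not> i \<le> k" "j \<le> k" using ij by linarith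
    then show ?thesis
    proof cases
      case 1
      then show ?thesis using B(2) ij(3) by (simp add: B'_def)
    next
      case 2
      then have "B i \<subseteq> I - T" using B(1) by blast
      then show ?thesis using 2 by (auto simp: B'_def)
    next
      case 3
      then have "B j \<subseteq> I - T" using B(1) by blast
      then show ?thesis using 3 by (auto simp: B'_def)
    qed
  qed
  ultimately show ?case by blast
qed

text \<open>
Greedy extraction gives \<open>C (n - 1) + 1\<close> disjoint blocks of \<open>m\<close> members with sum divisible by \<open>m\<close>:
before the last of them is taken, \<open>C (m n - 1) + 1 - C (n - 1) m = C (m - 1) + 1\<close> members are still
available. The bound for \<open>n\<close> is then applied to the block sums divided by \<open>m\<close>.
\<close>

lemma egz_bound_mult:
  assumes m: "egz_bound C m" "m > 0" and n: "egz_bound C n" "n > 0"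
  shows "egz_bound C (m * n)"
  unfolding egz_bound_def
proof (intro allI impI)
  fix I :: "nat set" and v :: "nat \<Rightarrow> vec"
  assume I: "finite I" "C * (m * n - 1) + 1 \<le> card I"
  define k where "k = C * (n - 1)"
  have "C * (m - 1) + 1 + k * m = C * (m * n - 1) + 1"
  proof -
    obtain m' n' where "m = Suc m'" "n = Suc n'" using m n by (metis gr0_implies_Suc)
    then show ?thesis by (simp add: k_def algebra_simps)
  qed
  then have "C * (m - 1) + 1 + k * m \<le> card I" using I(2) by simp
  then obtain B where blocks: "\<forall>i\<le>k. B i \<subseteq> I \<and> card (B i) = m \<and> null_mod m (sum v (B i))"
    and disj: "\<forall>i\<le>k. \<forall>j\<le>k. i \<noteq> j \<longrightarrow> B i \<inter> B j = {}"
    using disjoint_zero_sum_blocks[OF m(1) I(1), of k v] by blast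
  have B: "B i \<subseteq> I \<and> card (B i) = m \<and> null_mod m (sum v (B i))" if "i \<le> k" for i
    using blocks that by simp
  define w where "w i = (fst (sum v (B i)) div int m, fst (snd (sum v (B i))) div int m,
    snd (snd (sum v (B i))) div int m)" for i
  have w: "sum v (B i) = scl (int m) (w i)" if "i \<le> k" for i
    using B[OF that] by (auto simp: w_def scl_def null_mod_def prod_eq_iff)
  have "C * (n - 1) + 1 \<le> card {..k}" by (simp add: k_def)
  then obtain T where T: "T \<subseteq> {..k}" "card T = n" "null_mod n (sum w T)"
    using egz_boundD[OF n(1), of "{..k}" w] by auto
  have fT: "finite T" using T(1) by (auto intro: finite_subset)
  have fB: "\<forall>i\<in>T. finite (B i)" using B T(1) I(1) by (auto intro: finite_subset)
  have disjT: "\<forall>i\<in>T. \<forall>j\<in>T. i \<noteq> j \<longrightarrow> B i \<inter> B j = {}" using disj T(1) by auto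
  have "card (\<Union>i\<in>T. B i) = (\<Sum>i\<in>T. card (B i))"
    using fT fB disjT by (rule card_UN_disjoint)
  also have "\<dots> = (\<Sum>i\<in>T. m)" using B T(1) by (intro sum.cong) auto
  finally have card: "card (\<Union>i\<in>T. B i) = m * n" using T(2) by simp
  have "sum v (\<Union>i\<in>T. B i) = (\<Sum>i\<in>T. sum v (B i))"
    using fT fB disjT by (rule sum.UNION_disjoint)
  also have "\<dots> = (\<Sum>i\<in>T. scl (int m) (w i))" using w T(1) by (intro sum.cong) auto
  also have "\<dots> = scl (int m) (sum w T)"
    by (simp add: scl_def prod_eq_iff fst_sum snd_sum sum_distrib_left)
  finally have "null_mod (m * n) (sum v (\<Union>i\<in>T. B i))"
    using T(3) by (auto simp: null_mod_def scl_def)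
  moreover have "(\<Union>i\<in>T. B i) \<subseteq> I" using B T(1) by auto
  ultimately show "\<exists>T\<subseteq>I. card T = m * n \<and> null_mod (m * n) (sum v T)"
    using card by blast
qed

lemma egz_bound_all:
  assumes "n > 0"
  shows "egz_bound 20370 n"
  using assms
proof (induction n rule: less_induct)
  case (less n)
  show ?case
  proof (cases "n = 1")
    case True
    then show ?thesis using egz_bound_1 by simp
  next
    case False
    then obtain p where p: "prime p" "p dvd n" using prime_factor_nat by blast
    then obtain k where k: "n = p * k" by (auto elim: dvdE)
    have "egz_bound 20370 p" unfolding egz_bound_def using zero_sum_prime[OF p(1)] by blast
    moreover have "k > 0" "k < n" "p > 0" using less.prems k prime_gt_1_nat[OF p(1)] by auto
    moreover from this have "egz_bound 20370 k" by (intro less.IH)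
    ultimately show ?thesis unfolding k by (intro egz_bound_mult)
  qed
qed

text \<open>
This is \<open>\<eta>(G) \<le> s(G) - (exp(G) - 1)\<close>. The family is padded by \<open>n - 1\<close> zeros; the padding can be removed from a zero-sum
subfamily with \<open>n\<close> members without changing the sum, and one of the original members remains.
\<close>

lemma short_zero_sum:
  fixes v :: "nat \<Rightarrow> vec"
  assumes bound: "egz_bound (Suc C) n" and n: "n > 0"
    and I: "finite I" "C * (n - 1) + 1 \<le> card I"
  shows "\<exists>T\<subseteq>I. T \<noteq> {} \<and> card T \<le> n \<and> null_mod n (sum v T)"
proof -
  define E where "E = {Suc (Max I)..<Suc (Max I) + (n - 1)}"
  have disj: "I \<inter> E = {}" using Max_ge[OF I(1)] by (fastforce simp: E_def)
  have E: "finite E" "card E = n - 1" by (simp_all add: E_def)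
  define w where "w i = (if i \<in> I then v i else 0)" for i
  have "Suc C * (n - 1) + 1 \<le> card (I \<union> E)"
    using disj E I by (simp add: card_Un_disjoint)
  then obtain T where T: "T \<subseteq> I \<union> E" "card T = n" "null_mod n (sum w T)"
    using egz_boundD[OF bound, of "I \<union> E" w] I(1) E(1) by blast
  have fT: "finite T" using T(2) n by (auto intro: card_ge_0_finite)
  have "sum w T = sum w (T \<inter> I)"
    using fT by (intro sum.mono_neutral_right) (auto simp: w_def)
  also have "\<dots> = sum v (T \<inter> I)" by (intro sum.cong) (auto simp: w_def)
  finally have "null_mod n (sum v (T \<inter> I))" using T(3) by simp
  moreover have "T \<inter> I \<noteq> {}"
  proof
    assume "T \<inter> I = {}"
    then have "card T \<le> card E" using T(1) E(1) by (intro card_mono) auto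
    then show False using T(2) E(2) n by simp
  qed
  moreover have "card (T \<inter> I) \<le> n" using card_mono[OF fT, of "T \<inter> I"] T(2) by simp
  ultimately show ?thesis by blast
qed

section \<open>The groups and their invariants\<close>

lemma comm_group_cyclic_cube: "comm_group (cyclic_cube n)"
  unfolding cyclic_cube_def
proof (intro group.group_comm_groupI DirProd_group group_integer_mod_group)
qed (auto simp: add.commute)

lemma carrier_cyclic_cube: "n > 0 \<Longrightarrow> carrier (cyclic_cube n) = cell n"
  by (simp add: cyclic_cube_def cell_def carrier_integer_mod_group)

lemma one_cyclic_cube: "\<one>\<^bsub>cyclic_cube n\<^esub> = 0"
  by (simp add: cyclic_cube_def zero_prod_def)

lemma mult_cyclic_cube: "x \<otimes>\<^bsub>cyclic_cube n\<^esub> y = reduce n (x + y)"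
  by (simp add: cyclic_cube_def mult_DirProd' reduce_def)

lemma reduce_add_left: "reduce n (reduce n x + y) = reduce n (x + y)"
  and reduce_add_right: "reduce n (x + reduce n y) = reduce n (x + y)"
  and reduce_0: "reduce n 0 = 0"
  by (simp_all add: reduce_def mod_simps zero_prod_def)

lemma reduce_eq_0_iff: "reduce n x = 0 \<longleftrightarrow> null_mod n x"
  by (auto simp: reduce_def null_mod_def prod_eq_iff)

lemma pow_cyclic_cube: "x [^]\<^bsub>cyclic_cube n\<^esub> (k::nat) = reduce n (scl (int k) x)"
proof (induction k)
  case 0
  then show ?case by (simp add: one_cyclic_cube reduce_0 nat_pow_def)
next
  case (Suc k)
  have "x [^]\<^bsub>cyclic_cube n\<^esub> Suc k = x [^]\<^bsub>cyclic_cube n\<^esub> k \<otimes>\<^bsub>cyclic_cube n\<^esub> x"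
    by (simp add: nat_pow_def)
  then show ?case unfolding scl_Suc by (simp add: Suc mult_cyclic_cube reduce_add_left reduce_add_right add.commute)
qed

lemma sum_count_eq_sum_mset:
  assumes "finite A" "set_mset M \<subseteq> A"
  shows "(\<Sum>x\<in>A. scl (int (count M x)) x) = sum_mset M"
  using assms(2)
proof (induction M)
  case empty
  then show ?case by simp
next
  case (add y M)
  have "(\<Sum>x\<in>A. scl (int (count (add_mset y M) x)) x)
      = (\<Sum>x\<in>A. (if x = y then y else 0) + scl (int (count M x)) x)"
    by (intro sum.cong refl) (auto simp: scl_Suc simp del: of_nat_Suc)
  also have "\<dots> = y + sum_mset M"
    using add assms(1) by (simp add: sum.distrib)
  finally show ?case by simp
qed

lemma seq_sum_cyclic_cube:
  assumes "n > 0" "set_mset M \<subseteq> cell n"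
  shows "seq_sum (cyclic_cube n) M = reduce n (sum_mset M)"
proof -
  interpret comm_group "cyclic_cube n" by (rule comm_group_cyclic_cube)
  have "finprod (cyclic_cube n) (\<lambda>x. x [^]\<^bsub>cyclic_cube n\<^esub> f x) A
      = reduce n (\<Sum>x\<in>A. scl (int (f x)) x)"
    if "finite A" "A \<subseteq> carrier (cyclic_cube n)" for A and f :: "vec \<Rightarrow> nat"
    using that
  proof (induction A rule: finite_induct)
    case empty
    then show ?case by (simp add: one_cyclic_cube reduce_0)
  next
    case (insert x A)
    then have "finprod (cyclic_cube n) (\<lambda>x. x [^]\<^bsub>cyclic_cube n\<^esub> f x) (insert x A)
        = x [^]\<^bsub>cyclic_cube n\<^esub> f x \<otimes>\<^bsub>cyclic_cube n\<^esub> finprod (cyclic_cube n) (\<lambda>x. x [^]\<^bsub>cyclic_cube n\<^esub> f x) A"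
      by (intro finprod_insert) auto
    then show ?case
      using insert by (simp add: pow_cyclic_cube mult_cyclic_cube reduce_add_left reduce_add_right)
  qed
  then show ?thesis
    using assms unfolding seq_sum_def
    by (simp add: carrier_cyclic_cube sum_count_eq_sum_mset)
qed

lemma zero_sum_cyclic_cube:
  assumes "n > 0" "set_mset M \<subseteq> cell n"
  shows "zero_sum (cyclic_cube n) M \<longleftrightarrow> null_mod n (sum_mset M)"
  using assms by (simp add: zero_sum_def seq_sum_cyclic_cube one_cyclic_cube reduce_eq_0_iff)

lemma group_exponent_cyclic_cube:
  assumes "n > 0"
  shows "group_exponent (cyclic_cube n) = n"
  unfolding group_exponent_def
proof (rule Least_equality)
  show "0 < n \<and> (\<forall>x\<in>carrier (cyclic_cube n). x [^]\<^bsub>cyclic_cube n\<^esub> n = \<one>\<^bsub>cyclic_cube n\<^esub>)"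
    using assms by (auto simp: pow_cyclic_cube one_cyclic_cube reduce_eq_0_iff null_mod_def scl_def)
next
  fix e :: nat assume e: "0 < e \<and> (\<forall>x\<in>carrier (cyclic_cube n). x [^]\<^bsub>cyclic_cube n\<^esub> e = \<one>\<^bsub>cyclic_cube n\<^esub>)"
  show "n \<le> e"
  proof (cases "n = 1")
    case False
    then have "(1, 0, 0) \<in> carrier (cyclic_cube n)"
      using assms by (simp add: carrier_cyclic_cube cell_def)
    then have "null_mod n (scl (int e) (1, 0, 0))"
      using e by (auto simp: pow_cyclic_cube one_cyclic_cube reduce_eq_0_iff)
    then have "n dvd e" by (simp add: null_mod_def scl_def)
    then show ?thesis using e by (auto dest: dvd_imp_le)
  qed (use e in simp)
qed

text \<open>
A multiset is turned into a family by listing its members; subsets of the positions then correspond to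
submultisets.
\<close>

lemma zero_sum_subsequence_of_family:
  assumes n: "n > 0" and S: "set_mset S \<subseteq> carrier (cyclic_cube n)"
    and family: "\<And>v. \<exists>T\<subseteq>{..<size S}. P (card T) \<and> null_mod n (sum v T)"
  shows "\<exists>M. M \<subseteq># S \<and> P (size M) \<and> zero_sum (cyclic_cube n) M"
proof -
  obtain xs where xs: "mset xs = S" using ex_mset by blast
  then have len: "length xs = size S" by auto
  obtain T where T: "T \<subseteq> {..<length xs}" "P (card T)" "null_mod n (sum (\<lambda>i. xs ! i) T)"
    using family[of "\<lambda>i. xs ! i"] len by auto
  define M where "M = image_mset (\<lambda>i. xs ! i) (mset_set T)"
  have "S = image_mset (\<lambda>i. xs ! i) (mset_set {..<length xs})"
    by (metis xs map_nth mset_map mset_set_upto_eq_mset_upto)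
  moreover have "mset_set T \<subseteq># mset_set {..<length xs}"
    using T(1) by (intro subset_imp_msubset_mset_set) auto
  ultimately have MS: "M \<subseteq># S" unfolding M_def by (simp add: image_mset_subseteq_mono)
  have "set_mset M \<subseteq> cell n"
    using set_mset_mono[OF MS] S n by (auto simp: carrier_cyclic_cube)
  moreover have "sum_mset M = sum (\<lambda>i. xs ! i) T"
    by (simp add: M_def sum_unfold_sum_mset)
  ultimately have "zero_sum (cyclic_cube n) M" using T(3) n by (simp add: zero_sum_cyclic_cube)
  moreover have "size M = card T" by (simp add: M_def)
  ultimately show ?thesis using MS T(2) by metis
qed

lemma eta_cyclic_cube_le:
  assumes n: "n > 0"
  shows "\<forall>S. set_mset S \<subseteq> carrier (cyclic_cube n) \<and> 20369 * (n - 1) + 1 \<le> size S \<longrightarrow>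
     (\<exists>T. T \<subseteq># S \<and> T \<noteq> {#} \<and> size T \<in> {1..group_exponent (cyclic_cube n)} \<and> zero_sum (cyclic_cube n) T)"
proof (intro allI impI, elim conjE)
  fix S assume S: "set_mset S \<subseteq> carrier (cyclic_cube n)" "20369 * (n - 1) + 1 \<le> size S"
  have "\<exists>T\<subseteq>{..<size S}. (1 \<le> card T \<and> card T \<le> n) \<and> null_mod n (sum v T)" for v
  proof -
    have "egz_bound (Suc 20369) n" using egz_bound_all[OF n] by simp
    from short_zero_sum[OF this n, of "{..<size S}" v] S(2)
    obtain T where T: "T \<subseteq> {..<size S}" "T \<noteq> {}" "card T \<le> n" "null_mod n (sum v T)" by auto
    then have "1 \<le> card T" by (metis One_nat_def Suc_leI card_gt_0_iff finite_lessThan finite_subset)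
    then show ?thesis using T by blast
  qed
  from zero_sum_subsequence_of_family[OF n S(1) this]
  obtain M where "M \<subseteq># S" "1 \<le> size M" "size M \<le> n" "zero_sum (cyclic_cube n) M" by blast
  then show "\<exists>T. T \<subseteq># S \<and> T \<noteq> {#} \<and> size T \<in> {1..group_exponent (cyclic_cube n)} \<and> zero_sum (cyclic_cube n) T"
    using n by (intro exI[of _ M]) (auto simp: group_exponent_cyclic_cube)
qed

lemma eta_const_cyclic_cube_le:
  assumes "n > 0"
  shows "eta_const (cyclic_cube n) \<le> 20369 * (n - 1) + 1"
  unfolding eta_const_def by (rule Least_le) (rule eta_cyclic_cube_le[OF assms])

lemma s_const_cyclic_cube_le:
  assumes n: "n > 0"
  shows "s_const (cyclic_cube n) \<le> 20370 * (n - 1) + 1"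
  unfolding s_const_def
proof (rule Least_le, intro allI impI, elim conjE)
  fix S assume S: "set_mset S \<subseteq> carrier (cyclic_cube n)" "20370 * (n - 1) + 1 \<le> size S"
  have "\<exists>T\<subseteq>{..<size S}. card T = n \<and> null_mod n (sum v T)" for v
    using egz_boundD[OF egz_bound_all[OF n], of "{..<size S}" v] S(2) by auto
  from zero_sum_subsequence_of_family[OF n S(1) this]
  show "\<exists>T. T \<subseteq># S \<and> size T = group_exponent (cyclic_cube n) \<and> zero_sum (cyclic_cube n) T"
    using n by (auto simp: group_exponent_cyclic_cube)
qed

lemma eta_const_cyclic_cube_2_ge: "2 \<le> eta_const (cyclic_cube 2)"
proof (rule ccontr)
  let ?G = "cyclic_cube 2"
  assume "\<not> ?thesis"
  then have small: "eta_const ?G \<le> 1" by simp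
  define S :: "vec multiset" where "S = {#(1, 0, 0)#}"
  have short: "\<forall>S. set_mset S \<subseteq> carrier ?G \<and> eta_const ?G \<le> size S \<longrightarrow>
     (\<exists>T. T \<subseteq># S \<and> T \<noteq> {#} \<and> size T \<in> {1..group_exponent ?G} \<and> zero_sum ?G T)"
    unfolding eta_const_def by (rule LeastI) (rule eta_cyclic_cube_le, simp)
  have cell: "set_mset S \<subseteq> cell 2" by (simp add: S_def cell_def)
  then have "set_mset S \<subseteq> carrier ?G \<and> eta_const ?G \<le> size S"
    using small by (simp add: carrier_cyclic_cube S_def)
  then obtain T where T: "T \<subseteq># S" "T \<noteq> {#}" "zero_sum ?G T" using short by blast
  have "T = S" using T(1,2) unfolding S_def by (cases T) (auto simp: insert_subset_eq_iff)
  then have "null_mod 2 (sum_mset S)" using T(3) cell zero_sum_cyclic_cube[of 2 S] by simp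
  then show False by (simp add: S_def null_mod_def)
qed

text \<open>
The constant \<open>a3\<close> is a least real number, so the minimum has to be shown to exist. The conditions for
\<open>n \<ge> 2\<close> are closed lower bounds on the constant, the one for \<open>n = 1\<close> does not involve it, and positivity
survives at the infimum because \<open>eta_const (cyclic_cube 2) \<ge> 2\<close> forces every admissible constant to be
at least \<open>1\<close>.
\<close>

lemma a3_le:
  assumes C: "0 < C" "\<And>n. n \<ge> 1 \<Longrightarrow> real (eta_const (cyclic_cube n)) \<le> C * (real n - 1) + 1"
  shows "a3 \<le> C"
proof -
  define P where "P a \<longleftrightarrow> 0 < a \<and> (\<forall>n\<ge>1. real (eta_const (cyclic_cube n)) \<le> a * (real n - 1) + 1)" for a :: real
  define m where "m = Inf (Collect P)"
  have PC: "P C" using C by (simp add: P_def)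
  have below: "bdd_below (Collect P)" by (rule bdd_belowI[of _ 0]) (auto simp: P_def)
  have lower: "m \<le> a" if "P a" for a unfolding m_def using that below by (intro cInf_lower) auto
  have greatest: "b \<le> m" if "\<And>a. P a \<Longrightarrow> b \<le> a" for b
    unfolding m_def using PC that by (intro cInf_greatest) auto
  have "P m"
    unfolding P_def
  proof (intro conjI allI impI)
    have "1 \<le> a" if "P a" for a
    proof -
      have "\<forall>n\<ge>1. real (eta_const (cyclic_cube n)) \<le> a * (real n - 1) + 1"
        using that by (simp add: P_def)
      from spec[OF this, of 2] show ?thesis using eta_const_cyclic_cube_2_ge by simp
    qed
    then have "1 \<le> m" by (rule greatest)
    then show "0 < m" by simp
  next
    fix n :: nat assume n: "1 \<le> n"
    show "real (eta_const (cyclic_cube n)) \<le> m * (real n - 1) + 1"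
    proof (cases "n = 1")
      case True
      then show ?thesis using C(2)[of 1] by simp
    next
      case False
      then have pos: "real n - 1 > 0" using n by simp
      have "(real (eta_const (cyclic_cube n)) - 1) / (real n - 1) \<le> m"
        using n pos by (intro greatest) (auto simp: P_def pos_divide_le_eq algebra_simps)
      then show ?thesis using pos by (simp add: pos_divide_le_eq)
    qed
  qed
  then have "a3 = m"
    unfolding a3_def P_def[symmetric] using lower by (intro Least_equality)
  then show ?thesis using lower[OF PC] by simp
qed

theorem lemma3p8:
  shows "(\<forall>n::nat. n \<ge> 2 \<longrightarrow>
            eta_const (cyclic_cube n) \<le> 20369 * (n - 1) + 1 \<and>
            s_const (cyclic_cube n) \<le> 20370 * (n - 1) + 1)
         \<and> a3 \<le> 20369"
proof (intro conjI allI impI)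
  show "a3 \<le> 20369"
  proof (rule a3_le)
    fix n :: nat assume n: "n \<ge> 1"
    have "real (eta_const (cyclic_cube n)) \<le> real (20369 * (n - 1) + 1)"
      using eta_const_cyclic_cube_le[of n] n by (simp only: of_nat_le_iff)
    then show "real (eta_const (cyclic_cube n)) \<le> 20369 * (real n - 1) + 1"
      using n by (simp add: of_nat_diff)
  qed simp
qed (use eta_const_cyclic_cube_le s_const_cyclic_cube_le in auto)

end
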